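(* On the round two-sphere, identified conformally with $\mathbb{CP}_1$, the following list constitutes a classification of the conformally homogeneous unparameterised curves: (i) the round circles; (ii) the right-handed loxodromes with bearing $\beta>0$; (iii) the left-handed loxodromes with bearing $\beta<0$. That is, each curve in the list is conformally homogeneous and, conversely, every conformally homogeneous curve is (a connected open arc of) exactly one of the curves in the list.
   Context: A curve here is a connected smooth unparameterised curve in $S^2\cong\mathbb{CP}_1=\mathbb{C}\cup\{\infty\}$. $\mathrm{SL}(2,\mathbb{C})$ acts by Möbius transformations, and the conformal Killing fields are the real parts $X=\Re(Z)$ of the global holomorphic vector fields $Z=(az^2+bz+c)\,\partial/\partial z$ with $a,b,c\in\mathbb{C}$. A curve is conformally homogeneous if some subgroup of the conformal transformations acts transitively on it; infinitesimally, and this is the formulation used here, if its symmetry algebra is non-zero, i.e. there is a non-zero conformal Killing field everywhere tangent to the curve. Curves are regarded up to extension, so that an open arc of a curve is not distinguished from the curve. The round circles are the images under Möbius transformations of $\mathbb{RP}_1=\mathbb{R}\cup\{\infty\}\subset\mathbb{CP}_1$. For $\beta\in\mathbb{R}\setminus\{0\}$, a loxodrome with bearing $\beta$ is the image under a Möbius transformation of the logarithmic spiral $\{e^{(\beta+i)\theta}:\theta\in\mathbb{R}\}\subset\mathbb{C}$; it is called right-handed if $\beta>0$ and left-handed if $\beta<0$. *)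

theory Defs
  imports "HOL-Analysis.Analysis"
begin

section \<open>The Riemann sphere\<close>

text \<open>\<^term>\<open>None\<close> is the point at infinity. The two-sphere enters only through its conformal and
  smooth structure, so it is modelled directly as the complex projective line.\<close>

type_synonym cp1 = "complex option"

definition cp1_top :: "cp1 topology" where
  "cp1_top = Alexandroff_compactification euclidean"

definition moebius_cp1 :: "complex \<Rightarrow> complex \<Rightarrow> complex \<Rightarrow> complex \<Rightarrow> cp1 \<Rightarrow> cp1" where
  "moebius_cp1 a b c d p =
     (case p of
        None \<Rightarrow> (if c = 0 then None else Some (a / c))
      | Some z \<Rightarrow> (if c * z + d = 0 then None else Some (moebius a b c d z)))"

definition moebius_maps :: "(cp1 \<Rightarrow> cp1) set" where
  "moebius_maps = {moebius_cp1 a b c d | a b c d. a * d - b * c = 1}"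

text \<open>The smooth structure is given by the coordinate \<open>z\<close> away from infinity and the coordinate
  \<open>1 / z\<close> away from \<open>0\<close>. The function \<open>coord\<close> is meaningful only on \<open>chart_dom\<close>.\<close>

datatype chart = Affine | At_Infinity

fun chart_dom :: "chart \<Rightarrow> cp1 set" where
  "chart_dom Affine = - {None}"
| "chart_dom At_Infinity = - {Some 0}"

fun coord :: "chart \<Rightarrow> cp1 \<Rightarrow> complex" where
  "coord Affine p = the p"
| "coord At_Infinity p = (case p of None \<Rightarrow> 0 | Some z \<Rightarrow> 1 / z)"


section \<open>Smooth curves\<close>

text \<open>Infinitely often differentiable on \<open>S\<close>; only used for open \<open>S\<close>.\<close>

definition smooth_on :: "real set \<Rightarrow> (real \<Rightarrow> complex) \<Rightarrow> bool" where
  "smooth_on S f \<longleftrightarrow>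
     (\<exists>D :: nat \<Rightarrow> real \<Rightarrow> complex. (\<forall>t\<in>S. D 0 t = f t) \<and>
        (\<forall>n. \<forall>t\<in>S. (D n has_vector_derivative D (Suc n) t) (at t)))"

definition velocity :: "chart \<Rightarrow> (real \<Rightarrow> cp1) \<Rightarrow> real \<Rightarrow> complex" where
  "velocity k \<gamma> t = vector_derivative (coord k \<circ> \<gamma>) (at t)"

text \<open>Smooth immersions of an open interval. A closed curve is covered as well, being the image
  of a periodic immersion of the line.\<close>

definition regular_parametrisation :: "real set \<Rightarrow> (real \<Rightarrow> cp1) \<Rightarrow> bool" where
  "regular_parametrisation I \<gamma> \<longleftrightarrow>
     open I \<and> connected I \<and> I \<noteq> {} \<and>
     continuous_map (top_of_set I) cp1_top \<gamma> \<and>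
     (\<forall>k. smooth_on {t \<in> I. \<gamma> t \<in> chart_dom k} (coord k \<circ> \<gamma>)) \<and>
     (\<forall>k. \<forall>t\<in>I. \<gamma> t \<in> chart_dom k \<longrightarrow> velocity k \<gamma> t \<noteq> 0)"


section \<open>Conformal Killing fields and homogeneity\<close>

text \<open>A vector field is recorded by its components in the two charts, a real tangent vector
  \<open>u \<partial>/\<partial>x + v \<partial>/\<partial>y\<close> being written as \<open>u + i v\<close>. Since \<open>\<partial>/\<partial>z = (\<partial>/\<partial>x - i \<partial>/\<partial>y) / 2\<close>, the real
  part of \<open>f \<partial>/\<partial>z\<close> has component \<open>f / 2\<close>. With \<open>w = 1 / z\<close> one has \<open>\<partial>/\<partial>z = - w^2 \<partial>/\<partial>w\<close>, so that
  \<open>(a z^2 + b z + c) \<partial>/\<partial>z = - (a + b w + c w^2) \<partial>/\<partial>w\<close>.\<close>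

fun ckf :: "complex \<Rightarrow> complex \<Rightarrow> complex \<Rightarrow> chart \<Rightarrow> complex \<Rightarrow> complex" where
  "ckf a b c Affine z = (a * z^2 + b * z + c) / 2"
| "ckf a b c At_Infinity w = - (a + b * w + c * w^2) / 2"

definition conformal_killing_fields :: "(chart \<Rightarrow> complex \<Rightarrow> complex) set" where
  "conformal_killing_fields = {ckf a b c | a b c. True}"

definition tangent_along ::
    "(chart \<Rightarrow> complex \<Rightarrow> complex) \<Rightarrow> real set \<Rightarrow> (real \<Rightarrow> cp1) \<Rightarrow> bool" where
  "tangent_along X I \<gamma> \<longleftrightarrow>
     (\<forall>k. \<forall>t\<in>I. \<gamma> t \<in> chart_dom k \<longrightarrow> X k (coord k (\<gamma> t)) \<in> span {velocity k \<gamma> t})"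

definition symmetry_algebra ::
    "real set \<Rightarrow> (real \<Rightarrow> cp1) \<Rightarrow> (chart \<Rightarrow> complex \<Rightarrow> complex) set" where
  "symmetry_algebra I \<gamma> = {X \<in> conformal_killing_fields. tangent_along X I \<gamma>}"

text \<open>An unparameterised curve is the image of a regular parametrisation. Tangency does not
  change under reparametrisation.\<close>

definition conformally_homogeneous :: "cp1 set \<Rightarrow> bool" where
  "conformally_homogeneous C \<longleftrightarrow>
     (\<exists>I \<gamma>. regular_parametrisation I \<gamma> \<and> C = \<gamma> ` I \<and>
        (\<exists>X \<in> symmetry_algebra I \<gamma>. X \<noteq> (\<lambda>k z. 0)))"


section \<open>Circles and loxodromes\<close>

definition rp1 :: "cp1 set" where
  "rp1 = insert None (Some ` \<real>)"

definition round_circles :: "cp1 set set" where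
  "round_circles = {m ` rp1 | m. m \<in> moebius_maps}"

definition log_spiral :: "real \<Rightarrow> cp1 set" where
  "log_spiral \<beta> = range (\<lambda>\<theta>::real. Some (exp ((of_real \<beta> + \<i>) * of_real \<theta>)))"

definition loxodromes :: "real \<Rightarrow> cp1 set set" where
  "loxodromes \<beta> = {m ` log_spiral \<beta> | m. m \<in> moebius_maps}"

definition right_handed_loxodromes :: "cp1 set set" where
  "right_handed_loxodromes = (\<Union>\<beta>\<in>{0<..}. loxodromes \<beta>)"

definition left_handed_loxodromes :: "cp1 set set" where
  "left_handed_loxodromes = (\<Union>\<beta>\<in>{..<0}. loxodromes \<beta>)"

text \<open>Circles and loxodromes are embedded, so their topology is the subspace topology.\<close>

definition connected_open_arc_of :: "cp1 set \<Rightarrow> cp1 set \<Rightarrow> bool" where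
  "connected_open_arc_of C L \<longleftrightarrow>
     C \<noteq> {} \<and> connectedin cp1_top C \<and> openin (subtopology cp1_top L) C"

end

theory Submission
  imports Defs
begin

text \<open>Everything is done in homogeneous coordinates: a curve is locally \<open>[u : v]\<close>, and the field of a
  binary quadratic form \<open>Q\<close> is tangent to it iff \<open>Q(u, v) / (u' v - u v')\<close> is real, a condition
  equivariant under \<open>SL(2, \<complex>)\<close>. So one may assume that \<open>Q = k v\<^sup>2\<close> or \<open>Q = k u v\<close>.

  If \<open>Q = k u v\<close> with neither \<open>Re k\<close> nor \<open>Im k\<close> zero, the curve avoids the zeros of \<open>Q\<close> (at a zero
  the real ratio above would have derivative \<open>\<plusminus>k\<close>) and \<open>ln |z|\<close> parametrises it as a logarithmic spiral. In all other cases the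
  curve is locally circular wherever \<open>Q \<noteq> 0\<close>; it passes through zeros of \<open>Q\<close> only at isolated parameters,
  and there the two one-sided circles agree since a circle is determined by the 2-jet of a regular
  curve inside it.

  Conversely, one-parameter subgroups give solutions of linear systems \<open>(u, v)' = A (u, v)\<close>. Uniqueness
  of the circle comes from the 2-jet argument again, and that of the loxodrome from the linear
  independence of the exponentials \<open>exp (\<plusminus>(\<beta> \<plusminus> \<i>) \<theta>)\<close>, \<open>exp (2 \<beta> \<theta>)\<close> and \<open>1\<close> over an arc.\<close>

section \<open>Homogeneous coordinates and Moebius maps\<close>

text \<open>Where the field vanishes, tangency says nothing, so a curve through a fixed point of the
  flow could a priori pass from one integral curve to another. Contact of first order does not
  exclude this: for \<open>Q = k v^2\<close> the integral curves are the parallel lines in direction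
  \<open>k\<close>, which share one tangent direction at infinity and differ there only in the
  second-order jet. This is why jets of order two are compared, separately from the two sides of an
  exceptional parameter.

  Rescaling the lift (u, v) by a function multiplies Q(u, v) and u' v - u v' by the same square, so
  their quotient depends only on the curve and the field. In the normal form \<open>k u v\<close>
  the number \<open>k\<close> is, up to sign, the square root of the discriminant of Q, so the
  bearing Re k / Im k is determined by the field.

  Lying on a circle is the vanishing of Im (X cnj Y) with X and Y linear in u and v. Unlike a
  statement about sets, this equation can be differentiated along the curve and evaluated on the
  exponentials of a spiral.\<close>

definition proj :: "complex \<Rightarrow> complex \<Rightarrow> cp1" where
  "proj u v = (if v = 0 then None else Some (u / v))"

lemma proj_exhaust:
  obtains u v where "u \<noteq> 0 \<or> v \<noteq> 0" "x = proj u v"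
proof (cases x)
  case None
  then show ?thesis using that[of 1 0] by (simp add: proj_def)
next
  case (Some z)
  then show ?thesis using that[of z 1] by (simp add: proj_def)
qed

lemma linear_map_nonzero:
  fixes p q r s u v :: complex
  assumes "p * s - q * r \<noteq> 0" "u \<noteq> 0 \<or> v \<noteq> 0"
  shows "p * u + q * v \<noteq> 0 \<or> r * u + s * v \<noteq> 0"
proof (rule ccontr)
  assume "\<not> ?thesis"
  then have *: "p * u + q * v = 0" "r * u + s * v = 0" by auto
  \<comment> \<open>Cramer's rule: the adjugate matrix is applied to the two vanishing rows.\<close>
  have "(p * s - q * r) * u = s * (p * u + q * v) - q * (r * u + s * v)"
    and "(p * s - q * r) * v = p * (r * u + s * v) - r * (p * u + q * v)"
    by algebra+
  then show False using * assms by simp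
qed

text \<open>The pair (0, 0) is excluded because \<open>proj 0 0\<close> takes the default value
  \<open>None\<close>, which a Moebius map need not fix. With this identity, composition and
  inversion of Moebius maps become matrix algebra.\<close>

lemma moebius_proj:
  assumes "p * s - q * r \<noteq> 0" "u \<noteq> 0 \<or> v \<noteq> 0"
  shows "moebius_cp1 p q r s (proj u v) = proj (p * u + q * v) (r * u + s * v)"
proof (cases "v = 0")
  case True
  then show ?thesis using assms by (auto simp: proj_def moebius_cp1_def)
next
  case False
  have "r * (u / v) + s = (r * u + s * v) / v" "p * (u / v) + q = (p * u + q * v) / v"
    using False by (auto simp: field_simps)
  then show ?thesis using False by (auto simp: proj_def moebius_cp1_def moebius_def)
qed

lemma moebius_comp:
  assumes "a * d - b * c \<noteq> 0" "p * s - q * r \<noteq> 0"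
  shows "moebius_cp1 a b c d (moebius_cp1 p q r s x) =
         moebius_cp1 (a * p + b * r) (a * q + b * s) (c * p + d * r) (c * q + d * s) x"
proof -
  obtain u v where uv: "u \<noteq> 0 \<or> v \<noteq> 0" "x = proj u v" by (rule proj_exhaust)
  have "(a * p + b * r) * (c * q + d * s) - (a * q + b * s) * (c * p + d * r)
        = (a * d - b * c) * (p * s - q * r)" by algebra
  then have det: "(a * p + b * r) * (c * q + d * s) - (a * q + b * s) * (c * p + d * r) \<noteq> 0"
    using assms by simp
  show ?thesis
    using uv assms det linear_map_nonzero[of p s q r u v]
    by (simp add: moebius_proj algebra_simps)
qed

lemma moebius_scale:
  assumes "k \<noteq> 0"
  shows "moebius_cp1 (k * a) (k * b) (k * c) (k * d) = moebius_cp1 a b c d"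
proof
  fix x
  have "k * a * z + k * b = k * (a * z + b)" "k * c * z + k * d = k * (c * z + d)" for z
    by (auto simp: algebra_simps)
  then show "moebius_cp1 (k * a) (k * b) (k * c) (k * d) x = moebius_cp1 a b c d x"
    using assms by (auto simp: moebius_cp1_def moebius_def split: option.splits)
qed

text \<open>A complex determinant has a square root, so an invertible matrix can be rescaled to
  determinant 1 without changing its map. Concrete maps such as z -> d z + z0 can thus be written
  down unnormalised.\<close>

lemma moebius_maps_of_det:
  assumes "a * d - b * c \<noteq> 0"
  shows "moebius_cp1 a b c d \<in> moebius_maps"
proof -
  define k where "k = inverse (csqrt (a * d - b * c))"
  have "k * k * (a * d - b * c) = 1"
    using assms power2_csqrt[of "a * d - b * c"] by (simp add: k_def power2_eq_square field_simps)
  then have "k * a * (k * d) - k * b * (k * c) = 1" by (simp add: algebra_simps)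
  moreover have "k \<noteq> 0" using assms by (simp add: k_def)
  ultimately show ?thesis
    unfolding moebius_maps_def
      using moebius_scale[of k a b c d] by (intro CollectI exI[of _ "k * _"]) auto
qed

lemma moebius_id: "moebius_cp1 1 0 0 1 = id"
  by (auto simp: moebius_cp1_def moebius_def fun_eq_iff split: option.splits)

lemma moebius_cp1_inverse:
  assumes "p * s - q * r = 1"
  shows "moebius_cp1 s (- q) (- r) p (moebius_cp1 p q r s x) = x"
    and "moebius_cp1 p q r s (moebius_cp1 s (- q) (- r) p x) = x"
proof -
  have d: "p * s - q * r \<noteq> 0" "s * p - (- q) * (- r) \<noteq> 0"
    using assms by (auto simp: algebra_simps)
  have e: "s * p - q * r = 1" "- (r * q) + p * s = 1" "q * (- r) + s * p = 1" "- (q * r) + s * p = 1"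
    "p * s - q * r = 1"
    using assms by (auto simp: algebra_simps)
  show "moebius_cp1 s (- q) (- r) p (moebius_cp1 p q r s x) = x"
    using e by (simp add: moebius_comp[OF d(2,1)] moebius_id mult.commute)
  show "moebius_cp1 p q r s (moebius_cp1 s (- q) (- r) p x) = x"
    using e by (simp add: moebius_comp[OF d(1,2)] moebius_id mult.commute)
qed

lemma moebius_maps_comp:
  assumes "m \<in> moebius_maps" "n \<in> moebius_maps"
  shows "m \<circ> n \<in> moebius_maps"
proof -
  obtain a b c d where m: "m = moebius_cp1 a b c d" "a * d - b * c = 1"
    using assms by (auto simp: moebius_maps_def)
  obtain p q r s where n: "n = moebius_cp1 p q r s" "p * s - q * r = 1"
    using assms by (auto simp: moebius_maps_def)
  have "(a * p + b * r) * (c * q + d * s) - (a * q + b * s) * (c * p + d * r)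
        = (a * d - b * c) * (p * s - q * r)" by algebra
  then have "(a * p + b * r) * (c * q + d * s) - (a * q + b * s) * (c * p + d * r) \<noteq> 0"
    using m n by simp
  moreover have "m \<circ> n = moebius_cp1 (a * p + b * r) (a * q + b * s) (c * p + d * r) (c * q + d * s)"
    using m n by (auto simp: fun_eq_iff moebius_comp)
  ultimately show ?thesis by (simp add: moebius_maps_of_det)
qed

lemma moebius_maps_inverse:
  assumes "m \<in> moebius_maps"
  obtains m' where "m' \<in> moebius_maps" "\<And>x. m (m' x) = x" "\<And>x. m' (m x) = x"
proof -
  obtain p q r s where m: "m = moebius_cp1 p q r s" "p * s - q * r = 1"
    using assms by (auto simp: moebius_maps_def)
  have "moebius_cp1 s (- q) (- r) p \<in> moebius_maps"
    by (rule moebius_maps_of_det) (use m in \<open>simp add: algebra_simps\<close>)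
  then show ?thesis using that moebius_cp1_inverse[OF m(2)] m(1) by blast
qed

section \<open>The topology of the projective line in homogeneous coordinates\<close>

definition homogeneous_cone :: "cp1 set \<Rightarrow> (complex \<times> complex) set" where
  "homogeneous_cone T = {(u, v). (u \<noteq> 0 \<or> v \<noteq> 0) \<and> proj u v \<in> T}"

lemma open_quotient_preimage:
  fixes T :: "complex set"
  assumes "open T"
  shows "open {x :: complex \<times> complex. snd x \<noteq> 0 \<and> fst x / snd x \<in> T}"
proof -
  have o: "open {x :: complex \<times> complex. snd x \<noteq> 0}"
    by (intro open_Collect_neq continuous_intros)
  have "continuous_on {x :: complex \<times> complex. snd x \<noteq> 0} (\<lambda>x. fst x / snd x)"
    by (intro continuous_intros) auto
  from continuous_open_preimage[OF this o assms] show ?thesis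
    by (simp add: Collect_conj_eq vimage_def)
qed

text \<open>Openness of Moebius images and continuity of lifted curves are reduced by this to
  continuity of maps into C^2, with no special treatment of infinity. It identifies the one-point
  compactification with the quotient of C^2 minus the origin.\<close>

lemma openin_cp1_top_iff: "openin cp1_top T \<longleftrightarrow> open (homogeneous_cone T)"
proof
  assume "openin cp1_top T"
  then consider (a) W where "T = Some ` W" "open W"
    | (b) K where "T = insert None (Some ` (- K))" "compact K"
    by (auto simp: cp1_top_def openin_Alexandroff_compactification Compl_eq_Diff_UNIV)
  then show "open (homogeneous_cone T)"
  proof cases
    case a
    have "homogeneous_cone T = {x. snd x \<noteq> 0 \<and> fst x / snd x \<in> W}"
      by (auto simp: homogeneous_cone_def a proj_def split: if_splits)
    then show ?thesis using open_quotient_preimage[OF a(2)] by simp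
  next
    case b
    obtain B where B: "\<And>z. z \<in> K \<Longrightarrow> norm z \<le> B"
      using compact_imp_bounded[OF b(2)] by (auto simp: bounded_iff)
    \<comment> \<open>Near infinity the modulus of u / v exceeds the bound \<open>B\<close> of
      \<open>K\<close>. Written without division, the condition covers \<open>v = 0\<close> as well,
      and the strict inequality leaves out the origin.\<close>
    have o: "open {x :: complex \<times> complex. B * norm (snd x) < norm (fst x)}"
      by (intro open_Collect_less continuous_intros)
    have "homogeneous_cone T = {x. snd x \<noteq> 0 \<and> fst x / snd x \<in> - K} \<union> {x. B * norm (snd x) < norm (fst x)}"
    proof -
      have "u / v \<notin> K" if "B * norm v < norm u" "v \<noteq> 0" for u v
        using B[of "u / v"] that by (auto simp: norm_divide field_simps)
      then show ?thesis
        by (auto simp: homogeneous_cone_def b proj_def split: if_splits)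
    qed
    then show ?thesis
      using open_quotient_preimage[of "- K"] o b(2) by (simp add: open_Un compact_imp_closed open_Compl)
  qed
next
  assume o: "open (homogeneous_cone T)"
  have "open ((\<lambda>z. (z, 1 :: complex)) -` homogeneous_cone T)"
    by (rule open_vimage[OF o]) (intro continuous_intros)
  moreover have "(\<lambda>z. (z, 1)) -` homogeneous_cone T = {z. Some z \<in> T}"
    by (auto simp: homogeneous_cone_def proj_def)
  ultimately have o1: "open {z. Some z \<in> T}" by simp
  have that_image: "\<exists>W. T - {None} = Some ` W" for T :: "cp1 set"
    by (rule exI[of _ "{z. Some z \<in> T}"]) (auto simp: image_iff, metis option.exhaust)
  show "openin cp1_top T"
  proof (cases "None \<in> T")
    case False
    then obtain W where W: "T = Some ` W" using that_image[of T] by auto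
    have "W = {z. Some z \<in> T}" using W by auto
    then show ?thesis using o1 W
      by (auto simp: cp1_top_def)
  next
    case True
    \<comment> \<open>The slice (1, w) is the chart at infinity: a disc of radius \<open>e\<close>
      about w = 0 inside \<open>T\<close> confines the complement of \<open>T\<close> to the disc of
      radius 1 / e.\<close>
    have "open ((\<lambda>w. (1 :: complex, w :: complex)) -` homogeneous_cone T)"
      by (rule open_vimage[OF o]) (intro continuous_intros)
    moreover have "0 \<in> (\<lambda>w. (1, w)) -` homogeneous_cone T"
      using True by (auto simp: homogeneous_cone_def proj_def)
    ultimately obtain e
      where e: "e > 0" "ball 0 e \<subseteq> (\<lambda>w. (1, w)) -` homogeneous_cone T"
      by (meson open_contains_ball)
    have "norm z \<le> 1 / e" if "Some z \<notin> T" for z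
    proof (rule ccontr)
      assume n: "\<not> ?thesis"
      then have z: "z \<noteq> 0" using e by auto
      with n have "1 / z \<in> ball 0 e" using e by (auto simp: norm_divide field_simps)
      with e have "Some z \<in> T" using z by (auto simp: homogeneous_cone_def proj_def)
      with that show False by simp
    qed
    then have "bounded {z. Some z \<notin> T}" by (auto simp: bounded_iff)
    moreover have "closed {z. Some z \<notin> T}"
      using o1 by (simp add: closed_def Collect_neg_eq[symmetric])
    ultimately have "compact {z. Some z \<notin> T}" by (simp add: compact_eq_bounded_closed)
    moreover obtain W where W: "T - {None} = Some ` W" using that_image[of T] by blast
    have "z \<in> W \<longleftrightarrow> Some z \<in> T" for z
      using W by (metis Diff_iff imageE image_eqI option.distinct(1) option.inject singletonD)
    then have "W = UNIV - {z. Some z \<notin> T}" by auto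
    then have "T = insert None (Some ` (UNIV - {z. Some z \<notin> T}))"
      using True W by (metis insert_Diff)
    ultimately show ?thesis
      unfolding cp1_top_def openin_Alexandroff_compactification
      using \<open>closed _\<close> by (intro disjI2 exI[of _ "{z. Some z \<notin> T}"]) auto
  qed
qed

lemma topspace_cp1_top [simp]: "topspace cp1_top = UNIV"
proof -
  have "open (homogeneous_cone UNIV)"
  proof -
    have "homogeneous_cone UNIV = - {(0, 0)}" by (auto simp: homogeneous_cone_def)
    then show ?thesis by (simp add: open_Compl)
  qed
  then have "openin cp1_top UNIV" by (simp add: openin_cp1_top_iff)
  then show ?thesis using openin_subset by (metis top.extremum_uniqueI)
qed

lemma openin_moebius_image:
  assumes "m \<in> moebius_maps" "openin cp1_top T"
  shows "openin cp1_top (m ` T)"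
proof -
  obtain p q r s where m: "m = moebius_cp1 p q r s" "p * s - q * r = 1"
    using assms by (auto simp: moebius_maps_def)
  have d: "s * p - (- q) * (- r) \<noteq> 0" using m by (simp add: algebra_simps)
  have mem: "x \<in> m ` T \<longleftrightarrow> moebius_cp1 s (- q) (- r) p x \<in> T" for x
    using moebius_cp1_inverse[OF m(2)] m(1) by (metis imageE image_eqI)
  \<comment> \<open>The cone of the image is the preimage of the cone under the inverse matrix, a
    continuous linear map.\<close>
  have "homogeneous_cone (m ` T) = (\<lambda>x. (s * fst x + (- q) * snd x, (- r) * fst x + p * snd x)) -` homogeneous_cone T"
  proof (intro set_eqI, clarify)
    fix u v
    show "(u, v) \<in> homogeneous_cone (m ` T) \<longleftrightarrow>
      (u, v) \<in> (\<lambda>x. (s * fst x + (- q) * snd x, (- r) * fst x + p * snd x)) -` homogeneous_cone T"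
    proof (cases "u \<noteq> 0 \<or> v \<noteq> 0")
      case True
      then show ?thesis
        using linear_map_nonzero[OF d True] moebius_proj[OF d True]
          by (simp add: homogeneous_cone_def mem)
    qed (simp add: homogeneous_cone_def)
  qed
  moreover have "open \<dots>"
    by (rule open_vimage) (use assms(2) in \<open>auto simp: openin_cp1_top_iff intro!: continuous_intros\<close>)
  ultimately show ?thesis by (simp add: openin_cp1_top_iff)
qed

lemma openin_subtopology_moebius_image:
  assumes "m \<in> moebius_maps" "openin (subtopology cp1_top L) C"
  shows "openin (subtopology cp1_top (m ` L)) (m ` C)"
proof -
  obtain T where T: "openin cp1_top T" "C = T \<inter> L"
    using assms(2) by (auto simp: openin_subtopology)
  have "inj m" using moebius_maps_inverse[OF assms(1)] by (metis injI)
  then have "m ` C = m ` T \<inter> m ` L" using T by (simp add: image_Int)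
  then show ?thesis using openin_moebius_image[OF assms(1) T(1)] by (auto simp: openin_subtopology)
qed


section \<open>Orbits of one-parameter groups\<close>

lemma has_vector_derivative_quotient:
  fixes u v :: "real \<Rightarrow> complex"
  assumes "(u has_vector_derivative u') (at t)" "(v has_vector_derivative v') (at t)" "v t \<noteq> 0"
  shows "((\<lambda>t. u t / v t) has_vector_derivative (u' * v t - u t * v') / (v t)\<^sup>2) (at t)"
proof -
  have "(u has_derivative (\<lambda>x. x *\<^sub>R u')) (at t)" "(v has_derivative (\<lambda>x. x *\<^sub>R v')) (at t)"
    using assms by (auto simp: has_vector_derivative_def)
  from has_derivative_divide'[OF this assms(3)] show ?thesis
    unfolding has_vector_derivative_def
    by (rule has_derivative_eq_rhs)
      (auto simp: fun_eq_iff power2_eq_square scaleR_conv_of_real algebra_simps)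
qed

text \<open>Every derivative of a solution is a polynomial in the solution.\<close>

lemma smooth_on_polynomial_ode:
  assumes "\<And>t. t \<in> S \<Longrightarrow> (z has_vector_derivative poly R (z t)) (at t)"
  shows "smooth_on S z"
proof -
  define P where "P n = ((\<lambda>P. pderiv P * R) ^^ n) [:0, 1:]" for n
  have "((\<lambda>t. poly (P n) (z t)) has_vector_derivative poly (P (Suc n)) (z t)) (at t)"
    if "t \<in> S" for n t
    using field_vector_diff_chain_at[OF assms[OF that] poly_DERIV, of "P n"]
    by (simp add: P_def o_def mult.commute)
  then show ?thesis
    unfolding smooth_on_def by (intro exI[of _ "\<lambda>n t. poly (P n) (z t)"]) (simp add: P_def)
qed

lemma coord_proj:
  "v \<noteq> 0 \<Longrightarrow> coord Affine (proj u v) = u / v"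
  "u \<noteq> 0 \<Longrightarrow> coord At_Infinity (proj u v) = v / u"
  by (auto simp: proj_def)

lemma proj_in_chart_dom:
  "proj u v \<in> chart_dom Affine \<longleftrightarrow> v \<noteq> 0"
  "u \<noteq> 0 \<or> v \<noteq> 0 \<Longrightarrow> proj u v \<in> chart_dom At_Infinity \<longleftrightarrow> u \<noteq> 0"
  by (auto simp: proj_def)

text \<open>The quadratic form in the third hypothesis is the Wronskian u' v - u v' of the linear
  system. Its nonvanishing keeps the solution away from the origin and makes the projected orbit an
  immersion. The quotient u / v solves a Riccati equation, whose right-hand side is the affine
  component of a conformal Killing field.\<close>

lemma linear_flow_conformally_homogeneous:
  fixes u v :: "real \<Rightarrow> complex"
  assumes du: "\<And>t. (u has_vector_derivative p * u t + q * v t) (at t)"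
    and dv: "\<And>t. (v has_vector_derivative r * u t + s * v t) (at t)"
    and w: "\<And>t. q * (v t)\<^sup>2 + (p - s) * (u t * v t) - r * (u t)\<^sup>2 \<noteq> 0"
  shows "conformally_homogeneous (range (\<lambda>t. proj (u t) (v t)))"
proof -
  define \<gamma> where "\<gamma> t = proj (u t) (v t)" for t
  \<comment> \<open>The Riccati polynomials: z = u / v satisfies z' = q + (p - s) z - r z^2, and w =
    v / u satisfies w' = r + (s - p) w - q w^2.\<close>
  define R where "R k = (case k of Affine \<Rightarrow> [:q, p - s, - r:] | At_Infinity \<Rightarrow> [:r, s - p, - q:])"
    for k
  \<comment> \<open>The factors 2 compensate the 1 / 2 in \<open>ckf\<close>, so that
    \<open>X\<close> equals the velocity instead of being merely proportional to it.\<close>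
  define X where "X = ckf (- 2 * r) (2 * (p - s)) (2 * q)"
  have nz: "u t \<noteq> 0 \<or> v t \<noteq> 0" for t using w[of t] by auto
  have cont: "continuous_on UNIV u" "continuous_on UNIV v"
    using du dv by (auto intro!: continuous_at_imp_continuous_on has_vector_derivative_continuous)
  have X: "X k y = poly (R k) y" for k y
    by (cases k) (auto simp: X_def R_def field_simps power2_eq_square)
  have D: "((coord k \<circ> \<gamma>) has_vector_derivative poly (R k) (coord k (\<gamma> t))) (at t)"
    and NZ: "poly (R k) (coord k (\<gamma> t)) \<noteq> 0"
    if "\<gamma> t \<in> chart_dom k" for k t
  proof -
    show "((coord k \<circ> \<gamma>) has_vector_derivative poly (R k) (coord k (\<gamma> t))) (at t)"
    proof (cases k)
      case Affine
      have vt: "v t \<noteq> 0"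
        using that by (simp add: Affine \<gamma>_def proj_in_chart_dom del: chart_dom.simps)
      have o: "open {t. v t \<noteq> 0}" using cont by (intro open_Collect_neq continuous_intros)
      have "((\<lambda>t. u t / v t) has_vector_derivative poly (R k) (coord k (\<gamma> t))) (at t)"
        by (rule has_vector_derivative_eq_rhs[OF has_vector_derivative_quotient[OF du dv vt]])
          (use vt in \<open>simp add: R_def Affine \<gamma>_def coord_proj del: coord.simps,
            simp add: field_simps power2_eq_square\<close>)
      then show ?thesis
        by (rule has_vector_derivative_transform_within_open[OF _ o])
          (use vt in \<open>auto simp: Affine \<gamma>_def coord_proj simp del: coord.simps\<close>)
    next
      case At_Infinity
      have vt: "u t \<noteq> 0"
        using that nz by (simp add: At_Infinity \<gamma>_def proj_in_chart_dom del: chart_dom.simps)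
      have o: "open {t. u t \<noteq> 0}" using cont by (intro open_Collect_neq continuous_intros)
      have "((\<lambda>t. v t / u t) has_vector_derivative poly (R k) (coord k (\<gamma> t))) (at t)"
        by (rule has_vector_derivative_eq_rhs[OF has_vector_derivative_quotient[OF dv du vt]])
          (use vt in \<open>simp add: R_def At_Infinity \<gamma>_def coord_proj del: coord.simps,
            simp add: field_simps power2_eq_square\<close>)
      then show ?thesis
        by (rule has_vector_derivative_transform_within_open[OF _ o])
          (use vt in \<open>auto simp: At_Infinity \<gamma>_def coord_proj simp del: coord.simps\<close>)
    qed
    show "poly (R k) (coord k (\<gamma> t)) \<noteq> 0"
    proof (cases k)
      case Affine
      have vt: "v t \<noteq> 0"
        using that by (simp add: Affine \<gamma>_def proj_in_chart_dom del: chart_dom.simps)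
      then have "poly (R k) (coord k (\<gamma> t)) * (v t)\<^sup>2 = q * (v t)\<^sup>2 + (p - s) * (u t * v t) - r * (u t)\<^sup>2"
        by (simp add: R_def Affine \<gamma>_def coord_proj del: coord.simps)
          (simp add: field_simps power2_eq_square)
      with w[of t] show ?thesis by auto
    next
      case At_Infinity
      have vt: "u t \<noteq> 0"
        using that nz by (simp add: At_Infinity \<gamma>_def proj_in_chart_dom del: chart_dom.simps)
      then have "poly (R k) (coord k (\<gamma> t)) * (u t)\<^sup>2 = - (q * (v t)\<^sup>2 + (p - s) * (u t * v t) - r * (u t)\<^sup>2)"
        by (simp add: R_def At_Infinity \<gamma>_def coord_proj del: coord.simps)
          (simp add: field_simps power2_eq_square)
      with w[of t] show ?thesis by auto
    qed
  qed
  have vel: "velocity k \<gamma> t = poly (R k) (coord k (\<gamma> t))"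
    if "\<gamma> t \<in> chart_dom k" for k t
    using D[OF that] by (simp add: velocity_def vector_derivative_at)
  have "continuous_map (top_of_set UNIV) cp1_top \<gamma>"
    unfolding continuous_map_def
  proof (intro conjI allI impI)
    fix T assume "openin cp1_top T"
    then have "open (homogeneous_cone T)" by (simp add: openin_cp1_top_iff)
    then have "open ((\<lambda>t. (u t, v t)) -` homogeneous_cone T)"
      by (rule open_vimage) (use cont in \<open>intro continuous_intros\<close>)
    moreover have "(\<lambda>t. (u t, v t)) -` homogeneous_cone T = {x \<in> topspace (top_of_set UNIV). \<gamma> x \<in> T}"
      using nz by (auto simp: homogeneous_cone_def \<gamma>_def)
    ultimately show "openin (top_of_set UNIV) {x \<in> topspace (top_of_set UNIV). \<gamma> x \<in> T}"
      by simp
  qed auto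
  then have "regular_parametrisation UNIV \<gamma>"
    unfolding regular_parametrisation_def
    using vel NZ D by (auto intro!: smooth_on_polynomial_ode[where R = "R _"])
  moreover have "X \<in> symmetry_algebra UNIV \<gamma>"
    by (auto simp: symmetry_algebra_def conformal_killing_fields_def tangent_along_def vel X span_base)
      (auto simp: X_def)
  moreover have "X \<noteq> (\<lambda>k z. 0)"
  proof -
    obtain k where "\<gamma> 0 \<in> chart_dom k"
      by (metis nz[of 0] \<gamma>_def proj_in_chart_dom)
    then show ?thesis using NZ X by metis
  qed
  ultimately show ?thesis
    unfolding conformally_homogeneous_def \<gamma>_def by blast
qed

lemma moebius_proj_image_range:
  assumes "a * d - b * c = 1" "\<And>t. x t \<noteq> 0 \<or> y t \<noteq> 0"
  shows "moebius_cp1 a b c d ` range (\<lambda>t. proj (x t) (y t)) =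
         range (\<lambda>t. proj (a * x t + b * y t) (c * x t + d * y t))"
  using assms by (auto simp: image_iff moebius_proj)

text \<open>The rotation group acts transitively on the real projective line, so one orbit map
  defined on all of the reals reaches every point, infinity included; the affine coordinate as
  parameter would miss infinity.\<close>

lemma rp1_eq_range: "rp1 = range (\<lambda>t::real. proj (of_real (sin t)) (of_real (cos t)))"
proof (intro set_eqI iffI)
  fix x assume "x \<in> rp1"
  then consider "x = None" | r where "x = Some (complex_of_real r)" by (auto simp: rp1_def Reals_def)
  then show "x \<in> range (\<lambda>t::real. proj (of_real (sin t)) (of_real (cos t)))"
  proof cases
    case 1
    then show ?thesis by (intro range_eqI[of _ _ "pi / 2"]) (simp add: proj_def)
  next
    case 2
    have "cos (arctan r) \<noteq> 0" by (rule cos_arctan_not_zero)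
    moreover have "r = sin (arctan r) / cos (arctan r)" using tan_arctan[of r] by (simp add: tan_def)
    ultimately show ?thesis using 2
      by (intro range_eqI[of _ _ "arctan r"]) (auto simp: proj_def simp flip: of_real_divide)
  qed
qed (auto simp: proj_def rp1_def simp flip: of_real_divide)

lemma log_spiral_eq_range:
  "log_spiral \<beta> = range (\<lambda>\<theta>::real. proj (exp ((of_real \<beta> + \<i>) * of_real \<theta>)) 1)"
  by (simp add: log_spiral_def proj_def)

lemma has_vector_derivative_exp_mult:
  fixes l :: complex
  shows
  "((\<lambda>t::real. exp (l * of_real t)) has_vector_derivative l * exp (l * of_real t)) (at t)"
proof -
  have "((\<lambda>z. exp (l * z)) has_field_derivative l * exp (l * of_real t)) (at (of_real t))"
    by (auto intro!: derivative_eq_intros)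
  from has_vector_derivative_real_field[OF this] show ?thesis .
qed

lemma round_circle_conformally_homogeneous:
  assumes "L \<in> round_circles"
  shows "conformally_homogeneous L"
proof -
  obtain a b c d where L: "L = moebius_cp1 a b c d ` rp1" and det: "a * d - b * c = 1"
    using assms by (auto simp: round_circles_def moebius_maps_def)
  define x y where "x t = complex_of_real (sin t)" and "y t = complex_of_real (cos t)" for t
  have xy: "x t * x t + y t * y t = 1" for t
    unfolding x_def y_def of_real_mult[symmetric] of_real_add[symmetric]
    by (simp add: add.commute)
  have dx: "(x has_vector_derivative y t) (at t)" "(y has_vector_derivative - x t) (at t)" for t
    unfolding x_def y_def
      by (auto intro!: derivative_eq_intros simp: has_real_derivative_iff_has_vector_derivative[symmetric] of_real_minus[symmetric] has_vector_derivative_of_real simp del: of_real_minus)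
  have nz: "x t \<noteq> 0 \<or> y t \<noteq> 0" for t using xy[of t] by auto
  have L': "L = range (\<lambda>t. proj (a * x t + b * y t) (c * x t + d * y t))"
    using moebius_proj_image_range[OF det, of x y] nz by (simp add: L rp1_eq_range x_def y_def)
  show ?thesis unfolding L'
  \<comment> \<open>With M the matrix of the Moebius map and J the generator x' = y, y' = -x of
    rotations, these are the entries of M J M^(-1).\<close>
  proof (rule linear_flow_conformally_homogeneous[where p = "- (a * c + b * d)" and q = "a * a + b * b"
        and r = "- (c * c + d * d)" and s = "a * c + b * d"])
    fix t
    \<comment> \<open>Inserting the determinant, which is 1, turns the required equations into
      polynomial identities.\<close>
    have e: "a * y t - b * x t = (a * d - b * c) * (a * y t - b * x t)"
      "c * y t - d * x t = (a * d - b * c) * (c * y t - d * x t)" using det by auto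
    show "((\<lambda>t. a * x t + b * y t) has_vector_derivative
           - (a * c + b * d) * (a * x t + b * y t) + (a * a + b * b) * (c * x t + d * y t)) (at t)"
      by (rule has_vector_derivative_eq_rhs[of _ "a * y t - b * x t"], (auto intro!: derivative_eq_intros dx)[1])
        (subst e, algebra)
    show "((\<lambda>t. c * x t + d * y t) has_vector_derivative
           - (c * c + d * d) * (a * x t + b * y t) + (a * c + b * d) * (c * x t + d * y t)) (at t)"
      by (rule has_vector_derivative_eq_rhs[of _ "c * y t - d * x t"], (auto intro!: derivative_eq_intros dx)[1])
        (subst e, algebra)
    have "(a * a + b * b) * (c * x t + d * y t)\<^sup>2 +
         (- (a * c + b * d) - (a * c + b * d)) * ((a * x t + b * y t) * (c * x t + d * y t)) -
         - (c * c + d * d) * (a * x t + b * y t)\<^sup>2 = (a * d - b * c)^2 * (x t * x t + y t * y t)"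
      by algebra
    then show "(a * a + b * b) * (c * x t + d * y t)\<^sup>2 +
         (- (a * c + b * d) - (a * c + b * d)) * ((a * x t + b * y t) * (c * x t + d * y t)) -
         - (c * c + d * d) * (a * x t + b * y t)\<^sup>2 \<noteq> 0" using det xy[of t] by simp
  qed
qed

lemma loxodrome_conformally_homogeneous:
  assumes "L \<in> loxodromes \<beta>"
  shows "conformally_homogeneous L"
proof -
  obtain a b c d where L: "L = moebius_cp1 a b c d ` log_spiral \<beta>" and det: "a * d - b * c = 1"
    using assms by (auto simp: loxodromes_def moebius_maps_def)
  define l where "l = complex_of_real \<beta> + \<i>"
  have l0: "l \<noteq> 0" by (auto simp: l_def complex_eq_iff)
  define x where "x t = exp (l * complex_of_real t)" for t
  have dx: "(x has_vector_derivative l * x t) (at t)" for t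
    unfolding x_def by (rule has_vector_derivative_exp_mult)
  have L': "L = range (\<lambda>t. proj (a * x t + b) (c * x t + d))"
    using moebius_proj_image_range[OF det, of x "\<lambda>_. 1"]
      by (simp add: L log_spiral_eq_range x_def l_def)
  show ?thesis unfolding L'
  \<comment> \<open>The entries of M diag(l, 0) M^(-1): the spiral [exp (l t) : 1] is an orbit of
    the diagonal flow.\<close>
  proof (rule linear_flow_conformally_homogeneous[where p = "a * l * d" and q = "- (a * l * b)"
        and r = "c * l * d" and s = "- (c * l * b)"])
    fix t
    have e: "l * x t = (a * d - b * c) * (l * x t)" using det by auto
    show "((\<lambda>t. a * x t + b) has_vector_derivative
           a * l * d * (a * x t + b) + - (a * l * b) * (c * x t + d)) (at t)"
      by (rule has_vector_derivative_eq_rhs[of _ "a * (l * x t)"], (auto intro!: derivative_eq_intros dx)[1])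
        (subst e, algebra)
    show "((\<lambda>t. c * x t + d) has_vector_derivative
           c * l * d * (a * x t + b) + - (c * l * b) * (c * x t + d)) (at t)"
      by (rule has_vector_derivative_eq_rhs[of _ "c * (l * x t)"], (auto intro!: derivative_eq_intros dx)[1])
        (subst e, algebra)
    have "- (a * l * b) * (c * x t + d)\<^sup>2 +
         (a * l * d - - (c * l * b)) * ((a * x t + b) * (c * x t + d)) -
         c * l * d * (a * x t + b)\<^sup>2 = (a * d - b * c)^2 * (l * x t)"
      by algebra
    moreover have "x t \<noteq> 0" by (simp add: x_def)
    ultimately show "- (a * l * b) * (c * x t + d)\<^sup>2 +
         (a * l * d - - (c * l * b)) * ((a * x t + b) * (c * x t + d)) -
         c * l * d * (a * x t + b)\<^sup>2 \<noteq> 0" using det l0 by simp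
  qed
qed


section \<open>Circles and spirals\<close>

lemma rp1_proj:
  assumes "u \<noteq> 0 \<or> v \<noteq> 0"
  shows "proj u v \<in> rp1 \<longleftrightarrow> Im (u * cnj v) = 0"
proof (cases "v = 0")
  case False
  have "u / v \<in> \<real> \<longleftrightarrow> Im (u * cnj v) = 0"
    using False by (simp add: complex_is_Real_iff Im_divide complex_eq_iff)
      (auto simp: divide_simps sum_power2_eq_zero_iff)
  then show ?thesis using False by (auto simp: proj_def rp1_def)
qed (simp add: proj_def rp1_def)

lemma moebius_image_round_circles:
  "m \<in> moebius_maps \<Longrightarrow> L \<in> round_circles \<Longrightarrow> m ` L \<in> round_circles"
  unfolding round_circles_def using moebius_maps_comp by clarify (metis image_comp)

lemma moebius_image_loxodromes:
  "m \<in> moebius_maps \<Longrightarrow> L \<in> loxodromes \<beta> \<Longrightarrow> m ` L \<in> loxodromes \<beta>"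
  unfolding loxodromes_def using moebius_maps_comp by clarify (metis image_comp)

lemma mem_moebius_image_iff:
  assumes "p * s - q * r = 1"
  shows "x \<in> moebius_cp1 s (- q) (- r) p ` L \<longleftrightarrow> moebius_cp1 p q r s x \<in> L"
  using moebius_cp1_inverse[OF assms] by (metis imageE image_eqI)

lemma moebius_image_rp1_proj:
  assumes "p * s - q * r = 1" "u \<noteq> 0 \<or> v \<noteq> 0"
  shows "proj u v \<in> moebius_cp1 s (- q) (- r) p ` rp1
         \<longleftrightarrow> Im ((p * u + q * v) * cnj (r * u + s * v)) = 0"
  unfolding mem_moebius_image_iff[OF assms(1)]
  using assms linear_map_nonzero[of p s q r u v] by (simp add: moebius_proj rp1_proj)

text \<open>Pulling the form Im (u cnj v) of \<open>rp1\<close> back by the inverse matrix gives an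
  equation for any circle. Later arguments about circles work with the coefficients of this
  form.\<close>

lemma round_circle_form:
  assumes "L \<in> round_circles"
  obtains p q r s where "p * s - q * r = 1"
    "\<And>u v. u \<noteq> 0 \<or> v \<noteq> 0 \<Longrightarrow>
       proj u v \<in> L \<longleftrightarrow> Im ((p * u + q * v) * cnj (r * u + s * v)) = 0"
proof -
  obtain a b c d where L: "L = moebius_cp1 a b c d ` rp1" and det: "a * d - b * c = 1"
    using assms by (auto simp: round_circles_def moebius_maps_def)
  have det': "d * a - (- b) * (- c) = 1" using det by (simp add: algebra_simps)
  show ?thesis
    by (rule that[OF det']) (use moebius_image_rp1_proj[OF det'] L in simp)
qed

lemma round_circle_of_form:
  assumes "p * s - q * r \<noteq> 0"
  obtains L where "L \<in> round_circles"
    "\<And>u v. u \<noteq> 0 \<or> v \<noteq> 0 \<Longrightarrow> Im ((p * u + q * v) * cnj (r * u + s * v)) = 0 \<Longrightarrow> proj u v \<in> L"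
proof -
  have m: "moebius_cp1 p q r s \<in> moebius_maps" by (rule moebius_maps_of_det[OF assms])
  then obtain m' where m': "m' \<in> moebius_maps" "\<And>x. m' (moebius_cp1 p q r s x) = x"
    by (metis moebius_maps_inverse)
  show ?thesis
  proof (rule that)
    show "m' ` rp1 \<in> round_circles" using m' by (auto simp: round_circles_def)
    fix u v :: complex assume nz: "u \<noteq> 0 \<or> v \<noteq> 0" and "Im ((p * u + q * v) * cnj (r * u + s * v)) = 0"
    then have "moebius_cp1 p q r s (proj u v) \<in> rp1"
      using linear_map_nonzero[OF assms nz] by (simp add: moebius_proj[OF assms nz] rp1_proj)
    then show "proj u v \<in> m' ` rp1" by (metis m'(2) image_eqI)
  qed
qed

lemma round_circle_proper:
  assumes "L \<in> round_circles"
  obtains x where "x \<notin> L"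
proof -
  obtain m where m: "m \<in> moebius_maps" "L = m ` rp1"
    using assms by (auto simp: round_circles_def)
  obtain m' where "\<And>x. m' (m x) = x" using moebius_maps_inverse[OF m(1)] by metis
  moreover have "Some \<i> \<notin> rp1" by (auto simp: rp1_def complex_is_Real_iff)
  ultimately show ?thesis using that[of "m (Some \<i>)"] m(2) by (metis imageE)
qed

lemma real_moebius_rp1:
  assumes "a * d - b * c = 1" "a \<in> \<real>" "b \<in> \<real>" "c \<in> \<real>" "d \<in> \<real>"
  shows "moebius_cp1 a b c d ` rp1 = rp1"
proof -
  have sub: "moebius_cp1 a b c d ` rp1 \<subseteq> rp1"
    if "a \<in> \<real>" "b \<in> \<real>" "c \<in> \<real>" "d \<in> \<real>" for a b c d
    using that by (auto simp: rp1_def moebius_cp1_def moebius_def split: if_splits)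
  have "x \<in> moebius_cp1 a b c d ` rp1" if "x \<in> rp1" for x
    using moebius_cp1_inverse(2)[OF assms(1), of x] sub[of d "-b" "-c" a] that assms(2-5)
    by (metis Reals_minus image_eqI image_subset_iff)
  then show ?thesis using sub[OF assms(2-5)] by auto
qed

text \<open>Real Moebius maps preserve \<open>rp1\<close> and act transitively on it: translations
  move 0 to every finite point, and z -> -1 / z moves it to infinity. The contact point in the jet
  computation may therefore be placed at 0.\<close>

lemma round_circle_with_base_point:
  assumes "L \<in> round_circles" "x \<in> L"
  obtains m where "m \<in> moebius_maps" "L = m ` rp1" "x = m (Some 0)"
proof -
  obtain n y where n: "n \<in> moebius_maps" "L = n ` rp1" "x = n y" "y \<in> rp1"
    using assms by (auto simp: round_circles_def)
  have "\<exists>k \<in> moebius_maps. k ` rp1 = rp1 \<and> k (Some 0) = y"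
  proof (cases y)
    case None
    have "moebius_cp1 0 1 (- 1) 0 ` rp1 = rp1" by (rule real_moebius_rp1) auto
    then show ?thesis
      by (intro bexI[of _ "moebius_cp1 0 1 (- 1) 0"] conjI moebius_maps_of_det)
        (auto simp: None moebius_cp1_def)
  next
    case (Some r)
    then have "r \<in> \<real>" using n(4) by (auto simp: rp1_def)
    then have "moebius_cp1 1 r 0 1 ` rp1 = rp1" by (intro real_moebius_rp1) auto
    then show ?thesis
      by (intro bexI[of _ "moebius_cp1 1 r 0 1"] conjI moebius_maps_of_det)
        (auto simp: Some moebius_cp1_def moebius_def)
  qed
  then obtain k where k: "k \<in> moebius_maps" "k ` rp1 = rp1" "k (Some 0) = y" by auto
  have "L = (n \<circ> k) ` rp1" using n(2) k(2) by (metis image_comp)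
  then show ?thesis using that moebius_maps_comp[OF n(1) k(1)] n(3) k(3) by auto
qed

section \<open>Spiral arcs in circles and in other spirals\<close>

lemma vector_derivative_zero_of_vanishing:
  fixes f :: "real \<Rightarrow> 'a :: real_normed_vector"
  assumes "(f has_vector_derivative f') (at t)" "open S" "t \<in> S" "\<And>x. x \<in> S \<Longrightarrow> f x = 0"
  shows "f' = 0"
proof -
  have "((\<lambda>_. 0) has_vector_derivative f') (at t)"
    by (rule has_vector_derivative_transform_within_open[OF assms(1-3)]) (use assms(4) in simp)
  then show ?thesis using has_vector_derivative_const vector_derivative_unique_at by blast
qed

text \<open>\<open>Ln\<close> is applied to g x / g t, which is near 1 and so away from the branch
  cut. Only the real part of the logarithm is kept, so no branch has to be followed along the
  curve.\<close>

lemma ln_norm_has_derivative: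
  fixes g :: "real \<Rightarrow> complex"
  assumes g: "(g has_vector_derivative g') (at t)" and nz: "g t \<noteq> 0"
  shows "((\<lambda>x. ln (norm (g x))) has_vector_derivative Re (g' / g t)) (at t)"
proof -
  have "((\<lambda>x. g x / g t) has_vector_derivative g' / g t) (at t)"
    by (rule has_vector_derivative_divide[OF g])
  moreover have "(Ln has_field_derivative 1) (at (g t / g t))"
    using has_field_derivative_Ln[of 1] nz by (simp add: complex_nonpos_Reals_iff)
  ultimately have "((Ln \<circ> (\<lambda>x. g x / g t)) has_vector_derivative g' / g t * 1) (at t)"
    by (rule field_vector_diff_chain_at)
  then have "((\<lambda>x. Re (Ln (g x / g t))) has_vector_derivative Re (g' / g t)) (at t)"
    by (auto simp: o_def has_vector_derivative_complex_iff has_real_derivative_iff_has_vector_derivative)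
  then have d: "((\<lambda>x. Re (Ln (g x / g t)) + ln (norm (g t))) has_vector_derivative Re (g' / g t)) (at t)"
    by (auto intro!: derivative_eq_intros)
  have "isCont g t" using g by (rule has_vector_derivative_continuous)
  then obtain e where e: "e > 0" "\<And>x. dist x t < e \<Longrightarrow> g x \<noteq> 0"
    using nz continuous_at_avoid[of t g 0] by (auto simp: dist_commute)
  have "Re (Ln (g x / g t)) + ln (norm (g t)) = ln (norm (g x))" if "x \<in> ball t e" for x
    using e(2)[of x] that nz by (simp add: dist_commute norm_divide ln_div)
  then show ?thesis
    using e(1) by (intro has_vector_derivative_transform_within_open[OF d open_ball[of t e]]) auto
qed

text \<open>The equation is that of a circle, A |z|^2 + Im (B z) + C = 0, evaluated at z = exp (l
  \<theta>), where |z|^2 = exp (2 \<beta> \<theta>). Differentiation acts on the coefficients by (A,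
  B, C) -> (2 \<beta> A, l B, 0). The derivatives up to order three at one parameter form a linear
  system for the real unknowns X, Re Y, Im Y and C, nonsingular because \<beta> is nonzero.\<close>

lemma spiral_not_on_hermitian_curve:
  fixes A C \<beta> :: real and B :: complex
  defines "l \<equiv> of_real \<beta> + \<i>"
  assumes "a < b" "\<beta> \<noteq> 0"
    and vanish: "\<And>\<theta>::real. a < \<theta> \<Longrightarrow> \<theta> < b \<Longrightarrow>
      A * exp (2 * \<beta> * \<theta>) + Im (B * exp (l * of_real \<theta>)) + C = 0"
  shows "A = 0 \<and> B = 0 \<and> C = 0"
proof -
  define P where "P A B C \<longleftrightarrow> (\<forall>\<theta>\<in>{a<..<b}.
    A * exp (2 * \<beta> * \<theta>) + Im (B * exp (l * complex_of_real \<theta>)) + C = 0)" for A B and C :: real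
  have step: "P (2 * \<beta> * A) (l * B) 0" if "P A B C" for A B C
    unfolding P_def
  proof
    fix \<theta> assume \<theta>: "\<theta> \<in> {a<..<b}"
    have "((\<lambda>x. B * exp (l * complex_of_real x)) has_vector_derivative B * (l * exp (l * of_real \<theta>))) (at \<theta>)"
      by (intro derivative_intros has_vector_derivative_exp_mult)
    then have "((\<lambda>x. Im (B * exp (l * complex_of_real x))) has_real_derivative Im (B * (l * exp (l * of_real \<theta>)))) (at \<theta>)"
      by (simp add: has_vector_derivative_complex_iff)
    moreover have "((\<lambda>x. A * exp (2 * \<beta> * x)) has_real_derivative 2 * \<beta> * A * exp (2 * \<beta> * \<theta>)) (at \<theta>)"
      by (auto intro!: derivative_eq_intros)
    ultimately have "((\<lambda>x. A * exp (2 * \<beta> * x) + Im (B * exp (l * complex_of_real x)) + C) has_real_derivative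
       2 * \<beta> * A * exp (2 * \<beta> * \<theta>) + Im (B * (l * exp (l * of_real \<theta>))) + 0) (at \<theta>)"
      by (intro DERIV_add DERIV_const)
    then have "2 * \<beta> * A * exp (2 * \<beta> * \<theta>) + Im (B * (l * exp (l * of_real \<theta>))) + 0 = 0"
      unfolding has_real_derivative_iff_has_vector_derivative
      by (rule vector_derivative_zero_of_vanishing[where S = "{a<..<b}"])
        (use \<theta> that in \<open>auto simp: P_def\<close>)
    then show "2 * \<beta> * A * exp (2 * \<beta> * \<theta>) + Im (l * B * exp (l * of_real \<theta>)) + 0 = 0"
      by (simp only: mult_ac)
  qed
  define \<theta> where "\<theta> = (a + b) / 2"
  have \<theta>: "\<theta> \<in> {a<..<b}" using assms by (auto simp: \<theta>_def)
  define X where "X = A * exp (2 * \<beta> * \<theta>)"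
  define Y where "Y = B * exp (l * of_real \<theta>)"
  have P0: "P A B C" using vanish by (simp add: P_def)
  note P1 = step[OF P0] and P2 = step[OF step[OF P0]] and P3 = step[OF step[OF step[OF P0]]]
  have e0: "X + Im Y + C = 0" using P0 \<theta> by (simp add: P_def X_def Y_def)
  have "2 * \<beta> * X + Im (l * Y) = 0"
    using P1 \<theta> unfolding P_def X_def Y_def by (simp only: mult.assoc) auto
  then have e1: "2 * \<beta> * X + (\<beta> * Im Y + Re Y) = 0" by (simp add: l_def)
  have "2 * \<beta> * (2 * \<beta> * X) + Im (l * (l * Y)) = 0"
    using P2 \<theta> unfolding P_def X_def Y_def by (simp only: mult.assoc) auto
  then have e2: "4 * \<beta>^2 * X + ((\<beta>^2 - 1) * Im Y + 2 * \<beta> * Re Y) = 0"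
    by (simp add: l_def algebra_simps power2_eq_square)
  have "2 * \<beta> * (2 * \<beta> * (2 * \<beta> * X)) + Im (l * (l * (l * Y))) = 0"
    using P3 \<theta> unfolding P_def X_def Y_def by (simp only: mult.assoc) auto
  then have e3: "8 * \<beta>^3 * X + ((\<beta>^3 - 3 * \<beta>) * Im Y + (3 * \<beta>^2 - 1) * Re Y) = 0"
    by (simp add: l_def algebra_simps power2_eq_square power3_eq_cube)
  have pos: "\<beta>^2 + 1 > 0" by (simp add: add_nonneg_pos)
  \<comment> \<open>Subtracting 2 \<beta> times \<open>e1\<close> from \<open>e2\<close> eliminates
    both X and Re Y.\<close>
  have "(\<beta>^2 + 1) * Im Y = 0" using e1 e2 by algebra
  then have y2: "Im Y = 0" using pos by simp
  have "2 * \<beta> * (\<beta>^2 + 1) * X = 0" using e1 e3 y2 by algebra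
  then have X: "X = 0" using pos assms(3) by simp
  then have "Re Y = 0" using e1 y2 by simp
  then have "Y = 0" using y2 by (simp add: complex_eq_iff)
  then show ?thesis using X e0 by (auto simp: X_def Y_def)
qed

text \<open>Odd derivatives involve only X - Y and even ones only X + Y, where X and Y are the two
  exponential terms at the midpoint. Orders 1 and 3 determine the difference, orders 2 and 4 the
  sum; the original equation then gives the claim about B.\<close>

lemma spiral_laurent_not_real:
  fixes A B C :: complex and \<beta> :: real
  defines "l \<equiv> of_real \<beta> + \<i>"
  assumes "a < b" "\<beta> \<noteq> 0"
    and vanish: "\<And>\<theta>::real. a < \<theta> \<Longrightarrow> \<theta> < b \<Longrightarrow>
      Im (A * exp (l * of_real \<theta>) + B + C * exp (- l * of_real \<theta>)) = 0"
  shows "A = 0 \<and> C = 0 \<and> Im B = 0"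
proof -
  define P where "P A B C \<longleftrightarrow> (\<forall>\<theta>\<in>{a<..<b}.
    Im (A * exp (l * complex_of_real \<theta>) + B + C * exp (- l * complex_of_real \<theta>)) = 0)" for A B C
  have step: "P (l * A) 0 (- l * C)" if "P A B C" for A B C
    unfolding P_def
  proof
    fix \<theta> assume \<theta>: "\<theta> \<in> {a<..<b}"
    have "((\<lambda>x. A * exp (l * complex_of_real x) + B + C * exp (- l * complex_of_real x)) has_vector_derivative
       A * (l * exp (l * of_real \<theta>)) + 0 + C * (- l * exp (- l * of_real \<theta>))) (at \<theta>)"
      by (intro derivative_intros has_vector_derivative_exp_mult)
    then have "((\<lambda>x. Im (A * exp (l * complex_of_real x) + B + C * exp (- l * complex_of_real x))) has_real_derivative
       Im (A * (l * exp (l * of_real \<theta>)) + 0 + C * (- l * exp (- l * of_real \<theta>)))) (at \<theta>)"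
      unfolding has_vector_derivative_complex_iff by blast
    then have "Im (A * (l * exp (l * of_real \<theta>)) + 0 + C * (- l * exp (- l * of_real \<theta>))) = 0"
      unfolding has_real_derivative_iff_has_vector_derivative
      by (rule vector_derivative_zero_of_vanishing[where S = "{a<..<b}"])
        (use \<theta> that in \<open>auto simp: P_def\<close>)
    then show "Im (l * A * exp (l * of_real \<theta>) + 0 + - l * C * exp (- l * of_real \<theta>)) = 0"
      by (simp only: mult_ac)
  qed
  \<comment> \<open>Two derivatives multiply by l^2, whose imaginary part 2 \<beta> is nonzero, so a
    nonzero real number cannot stay real.\<close>
  have real_pair: "y = 0" if "Im y = 0" "Im (l * (l * y)) = 0" for y
  proof -
    have "Im (l * (l * y)) = 2 * \<beta> * Re y" using that(1) by (simp add: l_def)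
    then have "2 * \<beta> * Re y = 0" using that(2) by metis
    then show ?thesis using that(1) assms(3) by (simp add: complex_eq_iff)
  qed
  have l0: "l \<noteq> 0" by (simp add: l_def complex_eq_iff)
  define \<theta> where "\<theta> = (a + b) / 2"
  have \<theta>: "\<theta> \<in> {a<..<b}" using assms by (auto simp: \<theta>_def)
  define X where "X = A * exp (l * of_real \<theta>)"
  define Y where "Y = C * exp (- l * of_real \<theta>)"
  have P0: "P A B C" using vanish by (simp add: P_def)
  note P1 = step[OF P0] and P2 = step[OF step[OF P0]] and P3 = step[OF step[OF step[OF P0]]]
    and P4 = step[OF step[OF step[OF step[OF P0]]]]
  have val: "A' * exp (l * of_real \<theta>) + B' + C' * exp (- l * of_real \<theta>) = a' * X + B' + c' * Y"
    if "A' = a' * A" "C' = c' * C" for A' B' C' a' c'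
    using that by (simp add: X_def Y_def)
  have "Im ((l) * X + 0 + (- l) * Y) = 0"
    using bspec[OF P1[unfolded P_def] \<theta>]
    unfolding mult.assoc[symmetric] val[where a' = "l" and c' = "- l", OF refl refl] .
  then have e1: "Im (l * (X - Y)) = 0"
    by (rule arg_cong[where f = Im, THEN trans, rotated]) algebra
  have "Im ((l * l) * X + 0 + (- l * - l) * Y) = 0"
    using bspec[OF P2[unfolded P_def] \<theta>]
    unfolding mult.assoc[symmetric] val[where a' = "l * l" and c' = "- l * - l", OF refl refl] .
  then have e2: "Im (l * l * (X + Y)) = 0"
    by (rule arg_cong[where f = Im, THEN trans, rotated]) algebra
  have "Im ((l * l * l) * X + 0 + (- l * - l * - l) * Y) = 0"
    using bspec[OF P3[unfolded P_def] \<theta>]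
    unfolding mult.assoc[symmetric] val[where a' = "l * l * l" and c' = "- l * - l * - l", OF refl refl] .
  then have e3: "Im (l * (l * (l * (X - Y)))) = 0"
    by (rule arg_cong[where f = Im, THEN trans, rotated]) algebra
  have "Im ((l * l * l * l) * X + 0 + (- l * - l * - l * - l) * Y) = 0"
    using bspec[OF P4[unfolded P_def] \<theta>]
    unfolding mult.assoc[symmetric] val[where a' = "l * l * l * l" and c' = "- l * - l * - l * - l", OF refl refl] .
  then have e4: "Im (l * (l * (l * l * (X + Y)))) = 0"
    by (rule arg_cong[where f = Im, THEN trans, rotated]) algebra
  have "X - Y = 0" "X + Y = 0"
    using real_pair[OF e1 e3] real_pair[OF e2 e4] l0 by auto
  then have "X = 0" "Y = 0" by (auto simp: algebra_simps)
  then show ?thesis using P0 \<theta> by (auto simp: X_def Y_def P_def)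
qed

text \<open>If the equation of a circle held along the arc, all coefficients of its Hermitian form
  would vanish and the circle would be the whole sphere.\<close>

lemma spiral_arc_not_in_circle:
  assumes "a < b" "\<beta> \<noteq> 0" "L \<in> round_circles"
    and sub: "\<And>\<theta>::real. a < \<theta> \<Longrightarrow> \<theta> < b \<Longrightarrow> Some (exp ((of_real \<beta> + \<i>) * of_real \<theta>)) \<in> L"
  shows False
proof -
  obtain p q r s where det: "p * s - q * r = 1" and form:
    "\<And>u v. u \<noteq> 0 \<or> v \<noteq> 0 \<Longrightarrow> proj u v \<in> L \<longleftrightarrow> Im ((p * u + q * v) * cnj (r * u + s * v)) = 0"
    using round_circle_form[OF assms(3)] by metis
  \<comment> \<open>The term in \<open>cnj u\<close> is conjugated into one in \<open>u\<close>,
    which changes the sign of its imaginary part; this is the origin of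
    \<open>- cnj q * r\<close>.\<close>
  have expand: "Im ((p * u + q) * cnj (r * u + s)) =
      Im (p * cnj r) * (norm u)\<^sup>2 + Im ((p * cnj s - cnj q * r) * u) + Im (q * cnj s)" for u
    unfolding cmod_power2 by (simp add: algebra_simps power2_eq_square)
  have "Im (p * cnj r) * exp (2 * \<beta> * \<theta>) + Im ((p * cnj s - cnj q * r) * exp ((of_real \<beta> + \<i>) * of_real \<theta>))
       + Im (q * cnj s) = 0" if "a < \<theta>" "\<theta> < b" for \<theta>
  proof -
    define E where "E = exp ((of_real \<beta> + \<i>) * of_real \<theta>)"
    have "proj E 1 \<in> L" using sub[OF that] by (simp add: proj_def E_def)
    then have "Im ((p * E + q) * cnj (r * E + s)) = 0" using form[of E 1] by simp
    moreover have "(norm E)\<^sup>2 = exp (2 * \<beta> * \<theta>)"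
      by (simp add: E_def power2_eq_square flip: exp_add)
    ultimately show ?thesis unfolding expand by (simp add: E_def)
  qed
  from spiral_not_on_hermitian_curve[OF assms(1,2) this]
  have z: "Im (p * cnj r) = 0" "p * cnj s - cnj q * r = 0" "Im (q * cnj s) = 0" by auto
  have "proj u 1 \<in> L" for u using form[of u 1] expand[of u] z by simp
  moreover have "proj 1 0 \<in> L" using form[of 1 0] z by simp
  ultimately have "x \<in> L" for x
    by (cases x) (auto simp: proj_def)
  then show False using round_circle_proper[OF assms(3)] by blast
qed

lemma log_spiral_iff: "Some z \<in> log_spiral \<beta> \<longleftrightarrow> (\<exists>\<theta>::real. z = exp ((of_real \<beta> + \<i>) * of_real \<theta>))"
  by (auto simp: log_spiral_def)

text \<open>On the spiral |z| = exp (\<beta> \<theta>), so the parameter can be read off from the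
  modulus, without choosing an argument.\<close>

lemma log_spiral_eq_exp_ln:
  assumes "\<beta> \<noteq> 0" "Some z \<in> log_spiral \<beta>"
  shows "z = exp ((of_real \<beta> + \<i>) * of_real (ln (norm z) / \<beta>))"
  using assms by (auto simp: log_spiral_iff)

text \<open>Let E = exp (l \<theta>), and let g be the image of E. That g stays on the second spiral
  makes g' a real multiple of l' g. As the determinant is 1, this says that (l' / l) (p E + q) (r E
  + s) / E is real, a Laurent polynomial in E. Hence p r = q s = 0, and the map is z -> c z or z ->
  c / z.\<close>

lemma moebius_spiral_arc_in_spiral:
  assumes "a < b" "\<beta> \<noteq> 0" "\<beta>' \<noteq> 0" "p * s - q * r = 1"
    and sub: "\<And>\<theta>::real. a < \<theta> \<Longrightarrow> \<theta> < b \<Longrightarrow>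
      moebius_cp1 p q r s (Some (exp ((of_real \<beta> + \<i>) * of_real \<theta>))) \<in> log_spiral \<beta>'"
  shows "\<beta> = \<beta>' \<and> moebius_cp1 p q r s ` log_spiral \<beta> = log_spiral \<beta>'"
proof -
  define l l' where "l = complex_of_real \<beta> + \<i>" and "l' = complex_of_real \<beta>' + \<i>"
  have l0: "l \<noteq> 0" "l' \<noteq> 0" by (auto simp: l_def l'_def complex_eq_iff)
  define E where "E \<theta> = exp (l * complex_of_real \<theta>)" for \<theta>
  define g where "g \<theta> = (p * E \<theta> + q) / (r * E \<theta> + s)" for \<theta>
  have E0: "E \<theta> \<noteq> 0" for \<theta> by (simp add: E_def)
  have nz: "r * E \<theta> + s \<noteq> 0" "Some (g \<theta>) \<in> log_spiral \<beta>'"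
    if "a < \<theta>" "\<theta> < b" for \<theta>
    using sub[OF that]
      by (auto simp: moebius_cp1_def moebius_def g_def E_def l_def log_spiral_def split: if_splits)
  have g0: "g \<theta> \<noteq> 0" if "a < \<theta>" "\<theta> < b" for \<theta>
    using nz(2)[OF that] by (auto simp: log_spiral_def)
  have dE: "(E has_vector_derivative l * E \<theta>) (at \<theta>)" for \<theta>
    unfolding E_def by (rule has_vector_derivative_exp_mult)
  have "Im (p * r * (l' / l) * exp (l * of_real \<theta>) + (p * s + q * r) * (l' / l)
         + q * s * (l' / l) * exp (- l * of_real \<theta>)) = 0" if \<theta>: "a < \<theta>" "\<theta> < b" for \<theta>
  proof -
    define D where "D = l * E \<theta> / (r * E \<theta> + s)\<^sup>2"
    have "((\<lambda>x. (p * E x + q) / (r * E x + s)) has_vector_derivative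
       ((p * (l * E \<theta>) + 0) * (r * E \<theta> + s) - (p * E \<theta> + q) * (r * (l * E \<theta>) + 0)) / (r * E \<theta> + s)\<^sup>2) (at \<theta>)"
      by (rule has_vector_derivative_quotient) (intro derivative_intros dE nz \<theta>)+
    moreover have "(p * (l * E \<theta>) + 0) * (r * E \<theta> + s) - (p * E \<theta> + q) * (r * (l * E \<theta>) + 0) = l * E \<theta> * (p * s - q * r)"
      by algebra
    ultimately have dg: "(g has_vector_derivative D) (at \<theta>)"
      using assms(4) by (simp add: g_def[abs_def] D_def)
    \<comment> \<open>The real speed of the image in the parameter of the second spiral, which is ln
      |g| / \<beta>'.\<close>
    define \<kappa> where "\<kappa> = Re (D / g \<theta>) / \<beta>'"
    have "((\<lambda>x. ln (norm (g x)) / \<beta>') has_vector_derivative \<kappa>) (at \<theta>)"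
      unfolding \<kappa>_def
        by (intro has_vector_derivative_divide ln_norm_has_derivative dg g0 \<theta>)
    from vector_diff_chain_at[OF this has_vector_derivative_exp_mult[of l']]
    have "((\<lambda>x. exp (l' * of_real (ln (norm (g x)) / \<beta>'))) has_vector_derivative
        \<kappa> *\<^sub>R (l' * exp (l' * of_real (ln (norm (g \<theta>)) / \<beta>')))) (at \<theta>)"
      by (simp add: o_def)
    moreover have ge: "exp (l' * of_real (ln (norm (g x)) / \<beta>')) = g x" if "x \<in> {a<..<b}" for x
      unfolding l'_def by (rule log_spiral_eq_exp_ln[OF assms(3) nz(2), symmetric]) (use that in auto)
    ultimately have "((\<lambda>x. exp (l' * of_real (ln (norm (g x)) / \<beta>'))) has_vector_derivative
        \<kappa> *\<^sub>R (l' * g \<theta>)) (at \<theta>)" using ge[of \<theta>] \<theta> by (simp only: greaterThanLessThan_iff simp_thms)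
    then have "(g has_vector_derivative \<kappa> *\<^sub>R (l' * g \<theta>)) (at \<theta>)"
      by (rule has_vector_derivative_transform_within_open[where S = "{a<..<b}"]) (use \<theta> ge in auto)
    then have D: "D = \<kappa> * (l' * g \<theta>)"
      using vector_derivative_unique_at[OF dg] by (simp add: scaleR_conv_of_real)
    have "D \<noteq> 0" using nz(1)[OF \<theta>] E0 l0 by (simp add: D_def)
    then have \<kappa>: "\<kappa> \<noteq> 0" using D by auto
    have "l * E \<theta> = \<kappa> * l' * ((p * E \<theta> + q) * (r * E \<theta> + s))"
    proof -
      have *: "x = \<kappa> * l' * (M * N)"
        if "x / N\<^sup>2 = \<kappa> * (l' * (M / N))" "N \<noteq> 0" for x M N
        using that by (simp add: field_simps power2_eq_square)
      show ?thesis by (rule *) (use D nz(1)[OF \<theta>] in \<open>auto simp: D_def g_def\<close>)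
    qed
    then have "l' / l * ((p * E \<theta> + q) * (r * E \<theta> + s) / E \<theta>) = 1 / complex_of_real \<kappa>"
    proof -
      have *: "l' / l * (M / e) = 1 / k" if "l * e = k * l' * M" "e \<noteq> 0" "k \<noteq> 0" for M e k
      proof -
        have "k * (l' / l * (M / e)) = (k * l' * M) / (l * e)" by simp
        also have "\<dots> = 1" using that l0 by (simp flip: that(1))
        finally show ?thesis using that(3) by (simp add: field_simps)
      qed
      show ?thesis by (rule *) (use \<open>l * E \<theta> = _\<close> E0 \<kappa> in auto)
    qed
    moreover have "(p * E \<theta> + q) * (r * E \<theta> + s) / E \<theta> = p * r * E \<theta> + (p * s + q * r) + q * s / E \<theta>"
      using E0[of \<theta>] by (simp add: field_simps)
    ultimately have "Im (l' / l * (p * r * E \<theta> + (p * s + q * r) + q * s / E \<theta>)) = Im (1 / complex_of_real \<kappa>)"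
      by simp
    also have "\<dots> = 0" by (simp add: Im_divide_of_real)
    finally have "Im (l' / l * (p * r * E \<theta> + (p * s + q * r) + q * s / E \<theta>)) = 0" .
    moreover have "l' / l * (p * r * E \<theta> + (p * s + q * r) + q * s / E \<theta>) =
      p * r * (l' / l) * exp (l * of_real \<theta>) + (p * s + q * r) * (l' / l)
         + q * s * (l' / l) * exp (- l * of_real \<theta>)"
      unfolding E_def mult_minus_left exp_minus divide_inverse by algebra
    ultimately show ?thesis by simp
  qed
  from spiral_laurent_not_real[OF assms(1,2) this[unfolded l_def]]
  have z: "p * r = 0" "q * s = 0" "Im ((p * s + q * r) * (l' / l)) = 0"
    using l0 by (auto simp flip: l_def)
  define \<theta> where "\<theta> = (a + b) / 2"
  have \<theta>: "a < \<theta>" "\<theta> < b" using assms(1) by (auto simp: \<theta>_def)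
  have "(q = 0 \<and> r = 0 \<and> p * s = 1) \<or> (p = 0 \<and> s = 0 \<and> q * r = - 1)"
  proof (cases "p = 0")
    case True
    then have qr: "q * r = - 1" using assms(4) by (metis add.inverse_inverse diff_0 mult_zero_left)
    then have "s = 0" using z(2) by auto
    then show ?thesis using True qr by simp
  next
    case False
    then have "r = 0" using z(1) by simp
    then show ?thesis using z(2) assms(4) by auto
  qed
  \<comment> \<open>In either case p s + q r is 1 or -1, so l' / l is real; as l and l' both have
    imaginary part 1, they coincide.\<close>
  then have \<beta>: "\<beta> = \<beta>'"
  proof -
    have "Im (l' / l) = 0" using z(3) \<open>_ \<or> _\<close> by auto
    then have "Im (l' * cnj l) = 0"
      using l0 by (simp add: Im_divide complex_eq_iff) (auto simp: divide_simps sum_power2_eq_zero_iff)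
    then show ?thesis by (simp add: l_def l'_def)
  qed
  \<comment> \<open>One point of the image on the spiral determines the multiplier as an exponential
    of l times a real number. The map then acts on the parameter as a translation or a reflection of
    the real line.\<close>
  obtain \<phi> where \<phi>: "g \<theta> = exp (l * complex_of_real \<phi>)"
    using nz(2)[OF \<theta>] \<beta> by (auto simp: log_spiral_iff l_def)
  from \<open>_ \<or> _\<close> show ?thesis
  proof
    assume *: "q = 0 \<and> r = 0 \<and> p * s = 1"
    then have s: "s \<noteq> 0" by auto
    have k: "p / s = exp (l * (\<phi> - \<theta>))"
      using \<phi> * E0[of \<theta>] by (simp add: g_def E_def right_diff_distrib exp_diff field_simps)
    have "moebius_cp1 p q r s (Some (exp (l * x))) = Some (exp (l * (x + (\<phi> - \<theta>))))" for x
    proof -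
      have "moebius_cp1 p q r s (Some (exp (l * x))) = Some (p / s * exp (l * x))"
        using * s by (simp add: moebius_cp1_def moebius_def)
      then show ?thesis unfolding k by (simp add: algebra_simps flip: exp_add)
    qed
    note act = this
    have "moebius_cp1 p q r s ` log_spiral \<beta> = log_spiral \<beta>"
      unfolding log_spiral_def l_def[symmetric]
    proof (intro set_eqI iffI)
      fix x assume "x \<in> moebius_cp1 p q r s ` range (\<lambda>\<theta>. Some (exp (l * complex_of_real \<theta>)))"
      then obtain y
        where "x = Some (exp (l * (complex_of_real y + (\<phi> - \<theta>))))" using act by auto
      then show "x \<in> range (\<lambda>\<theta>. Some (exp (l * complex_of_real \<theta>)))"
        by (intro range_eqI[of _ _ "y + (\<phi> - \<theta>)"]) simp
    next
      fix x assume "x \<in> range (\<lambda>\<theta>. Some (exp (l * complex_of_real \<theta>)))"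
      then obtain y where "x = Some (exp (l * complex_of_real y))" by auto
      then have "x = moebius_cp1 p q r s (Some (exp (l * complex_of_real (y - (\<phi> - \<theta>)))))"
        unfolding act by simp
      then show "x \<in> moebius_cp1 p q r s ` range (\<lambda>\<theta>. Some (exp (l * complex_of_real \<theta>)))"
        by blast
    qed
    then show ?thesis using \<beta> by simp
  next
    assume *: "p = 0 \<and> s = 0 \<and> q * r = - 1"
    then have r: "r \<noteq> 0" by auto
    have k: "q / r = exp (l * (\<phi> + \<theta>))"
      using \<phi> * E0[of \<theta>] r by (simp add: g_def E_def distrib_left exp_add field_simps)
    have act: "moebius_cp1 p q r s (Some (exp (l * x))) = Some (exp (l * ((\<phi> + \<theta>) - x)))" for x
    proof -
      have "moebius_cp1 p q r s (Some (exp (l * x))) = Some (q / r / exp (l * x))"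
        using * r by (simp add: moebius_cp1_def moebius_def)
      then show ?thesis unfolding k by (simp add: algebra_simps flip: exp_diff)
    qed
    have "moebius_cp1 p q r s ` log_spiral \<beta> = log_spiral \<beta>"
      unfolding log_spiral_def l_def[symmetric]
    proof (intro set_eqI iffI)
      fix x assume "x \<in> moebius_cp1 p q r s ` range (\<lambda>\<theta>. Some (exp (l * complex_of_real \<theta>)))"
      then obtain y
        where "x = Some (exp (l * ((\<phi> + \<theta>) - complex_of_real y)))" using act by auto
      then show "x \<in> range (\<lambda>\<theta>. Some (exp (l * complex_of_real \<theta>)))"
        by (intro range_eqI[of _ _ "(\<phi> + \<theta>) - y"]) simp
    next
      fix x assume "x \<in> range (\<lambda>\<theta>. Some (exp (l * complex_of_real \<theta>)))"
      then obtain y where "x = Some (exp (l * complex_of_real y))" by auto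
      then have "x = moebius_cp1 p q r s (Some (exp (l * complex_of_real ((\<phi> + \<theta>) - y))))"
        unfolding act by simp
      then show "x \<in> moebius_cp1 p q r s ` range (\<lambda>\<theta>. Some (exp (l * complex_of_real \<theta>)))"
        by blast
    qed
    then show ?thesis using \<beta> by simp
  qed
qed


section \<open>Local lifts of curves\<close>

text \<open>\<open>U n\<close> and \<open>V n\<close> are the n-th derivatives of a lift, supplied
  together with it. The last clause, a nonvanishing Wronskian, is the immersion condition and also
  keeps the lift away from the origin.\<close>

definition jet_lift ::
    "real set \<Rightarrow> (real \<Rightarrow> cp1) \<Rightarrow> (nat \<Rightarrow> real \<Rightarrow> complex) \<Rightarrow> (nat \<Rightarrow> real \<Rightarrow> complex) \<Rightarrow> bool" where
  "jet_lift S \<gamma> U V \<longleftrightarrow>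
     open S \<and>
     (\<forall>n. \<forall>t\<in>S. (U n has_vector_derivative U (Suc n) t) (at t)) \<and>
     (\<forall>n. \<forall>t\<in>S. (V n has_vector_derivative V (Suc n) t) (at t)) \<and>
     (\<forall>t\<in>S. \<gamma> t = proj (U 0 t) (V 0 t)) \<and>
     (\<forall>t\<in>S. U 1 t * V 0 t - U 0 t * V 1 t \<noteq> 0)"

text \<open>Local lifts replace charts because linear maps preserve them, so this class of curves is
  closed under Moebius maps without a case distinction at infinity.\<close>

definition smooth_curve :: "real set \<Rightarrow> (real \<Rightarrow> cp1) \<Rightarrow> bool" where
  "smooth_curve I \<gamma> \<longleftrightarrow>
     open I \<and> connected I \<and> I \<noteq> {} \<and> (\<forall>t\<in>I. \<exists>S U V. t \<in> S \<and> S \<subseteq> I \<and> jet_lift S \<gamma> U V)"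

definition tangent_form ::
    "complex \<Rightarrow> complex \<Rightarrow> complex \<Rightarrow> real set \<Rightarrow> (real \<Rightarrow> cp1) \<Rightarrow> bool" where
  "tangent_form a b c I \<gamma> \<longleftrightarrow>
     (\<forall>S U V t. jet_lift S \<gamma> U V \<longrightarrow> t \<in> S \<inter> I \<longrightarrow>
        (a * (U 0 t)\<^sup>2 + b * (U 0 t * V 0 t) + c * (V 0 t)\<^sup>2) / (U 1 t * V 0 t - U 0 t * V 1 t) \<in> \<real>)"

lemma jet_liftD:
  assumes "jet_lift S \<gamma> U V"
  shows "open S"
    "\<And>n t. t \<in> S \<Longrightarrow> (U n has_vector_derivative U (Suc n) t) (at t)"
    "\<And>n t. t \<in> S \<Longrightarrow> (V n has_vector_derivative V (Suc n) t) (at t)"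
    "\<And>t. t \<in> S \<Longrightarrow> \<gamma> t = proj (U 0 t) (V 0 t)"
    "\<And>t. t \<in> S \<Longrightarrow> U 1 t * V 0 t - U 0 t * V 1 t \<noteq> 0"
    "\<And>t. t \<in> S \<Longrightarrow> U 0 t \<noteq> 0 \<or> V 0 t \<noteq> 0"
    "\<And>n t. t \<in> S \<Longrightarrow> isCont (U n) t"
    "\<And>n t. t \<in> S \<Longrightarrow> isCont (V n) t"
  using assms unfolding jet_lift_def
  by (blast, blast, blast, blast, blast, fastforce, (blast intro: has_vector_derivative_continuous)+)

lemma smooth_curveE:
  assumes "smooth_curve I \<gamma>" "t \<in> I"
  obtains S U V where "t \<in> S" "S \<subseteq> I" "jet_lift S \<gamma> U V"
  using assms unfolding smooth_curve_def by blast

lemma open_subset_nonzero: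
  fixes f :: "real \<Rightarrow> complex"
  assumes "open S" "\<And>t. t \<in> S \<Longrightarrow> isCont f t"
  shows "open {t \<in> S. f t \<noteq> 0}"
proof -
  have "continuous_on S f" using assms by (simp add: continuous_at_imp_continuous_on)
  from continuous_open_preimage[OF this assms(1), of "- {0}"]
  show ?thesis by (simp add: Int_def vimage_def open_Compl)
qed

lemma jet_lift_affine_coordinate:
  assumes lift: "jet_lift S \<gamma> U V" and t: "t \<in> S" "V 0 t \<noteq> 0"
  shows "((\<lambda>s. the (\<gamma> s)) has_vector_derivative (U 1 t * V 0 t - U 0 t * V 1 t) / (V 0 t)\<^sup>2) (at t)"
proof (rule has_vector_derivative_transform_within_open)
  show "((\<lambda>s. U 0 s / V 0 s) has_vector_derivative (U 1 t * V 0 t - U 0 t * V 1 t) / (V 0 t)\<^sup>2) (at t)"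
    using has_vector_derivative_quotient[OF jet_liftD(2,3)[OF lift t(1), of 0] t(2)] by simp
  show "open {s \<in> S. V 0 s \<noteq> 0}"
    using jet_liftD[OF lift] by (intro open_subset_nonzero)
qed (use t jet_liftD(4)[OF lift] in \<open>auto simp: proj_def\<close>)

lemma jet_lift_infinity_coordinate:
  assumes lift: "jet_lift S \<gamma> U V" and t: "t \<in> S" "U 0 t \<noteq> 0"
  shows "((coord At_Infinity \<circ> \<gamma>) has_vector_derivative
           (V 1 t * U 0 t - V 0 t * U 1 t) / (U 0 t)\<^sup>2) (at t)"
proof (rule has_vector_derivative_transform_within_open)
  show "((\<lambda>s. V 0 s / U 0 s) has_vector_derivative (V 1 t * U 0 t - V 0 t * U 1 t) / (U 0 t)\<^sup>2) (at t)"
    using has_vector_derivative_quotient[OF jet_liftD(3,2)[OF lift t(1), of 0] t(2)] by simp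
  show "open {s \<in> S. U 0 s \<noteq> 0}"
    using jet_liftD[OF lift] by (intro open_subset_nonzero)
qed (use t jet_liftD(4)[OF lift] in \<open>auto simp: coord_proj simp del: coord.simps\<close>)

lemma open_param_chart_dom:
  assumes "regular_parametrisation I \<gamma>"
  shows "open {t \<in> I. \<gamma> t \<in> chart_dom k}"
proof -
  have c: "continuous_map (top_of_set I) cp1_top \<gamma>" and o: "open I"
    using assms by (auto simp: regular_parametrisation_def)
  have "openin cp1_top (chart_dom k)"
  proof (cases k)
    case Affine
    have "- {None} = Some ` (UNIV :: complex set)" by (auto simp: notin_range_Some)
    then show ?thesis by (simp add: Affine cp1_top_def)
  next
    case At_Infinity
    have "homogeneous_cone (chart_dom k) = {x. fst x \<noteq> 0}"
      by (auto simp: homogeneous_cone_def At_Infinity proj_def)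
    moreover have "open {x :: complex \<times> complex. fst x \<noteq> 0}"
      by (intro open_Collect_neq continuous_intros)
    ultimately show ?thesis by (simp add: openin_cp1_top_iff)
  qed
  then have "openin (top_of_set I) {t \<in> I. \<gamma> t \<in> chart_dom k}"
    using c by (auto simp: continuous_map_def)
  then show ?thesis using o by (simp add: openin_open_eq)
qed

lemma regular_parametrisation_imp_smooth_curve:
  assumes reg: "regular_parametrisation I \<gamma>"
  shows "smooth_curve I \<gamma>"
  unfolding smooth_curve_def
proof (intro conjI ballI)
  fix t assume t: "t \<in> I"
  have ex: "\<exists>D. (\<forall>t\<in>S. D 0 t = coord k (\<gamma> t)) \<and> (\<forall>n. \<forall>t\<in>S. (D n has_vector_derivative D (Suc n) t) (at t))
      \<and> (\<forall>t\<in>S. D 1 t \<noteq> 0) \<and> open S" if S: "S = {t \<in> I. \<gamma> t \<in> chart_dom k}" for k S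
  proof -
    have o: "open S" unfolding S by (rule open_param_chart_dom[OF reg])
    have "smooth_on S (coord k \<circ> \<gamma>)"
      and vel: "\<forall>t\<in>S. velocity k \<gamma> t \<noteq> 0"
      using reg S unfolding regular_parametrisation_def by auto
    then obtain D where D: "\<forall>t\<in>S. D 0 t = (coord k \<circ> \<gamma>) t"
      "\<forall>n. \<forall>t\<in>S. (D n has_vector_derivative D (Suc n) t) (at t)"
      unfolding smooth_on_def by blast
    have "velocity k \<gamma> t = D 1 t" if "t \<in> S" for t
    proof -
      have "((coord k \<circ> \<gamma>) has_vector_derivative D 1 t) (at t)"
        by (rule has_vector_derivative_transform_within_open[OF _ o that, of "D 0"]) (use D that in auto)
      then show ?thesis by (simp add: velocity_def vector_derivative_at)
    qed
    then show ?thesis using D vel o by (intro exI[of _ D]) (auto simp: o_def)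
  qed
  \<comment> \<open>The constant 1 with its derivatives. Next to a chart coordinate it serves as the
    other homogeneous coordinate, and the Wronskian is then plus or minus the velocity.\<close>
  define one :: "nat \<Rightarrow> real \<Rightarrow> complex"
    where "one n t = (if n = 0 then 1 else 0)" for n t
  have d_one: "(one n has_vector_derivative one (Suc n) t) (at t)" for n t
    by (cases n) (auto simp: one_def[abs_def])
  show "\<exists>S U V. t \<in> S \<and> S \<subseteq> I \<and> jet_lift S \<gamma> U V"
  proof (cases "\<gamma> t = None")
    case False
    define S where "S = {t \<in> I. \<gamma> t \<in> chart_dom Affine}"
    from ex[OF S_def] obtain D where D: "\<forall>t\<in>S. D 0 t = coord Affine (\<gamma> t)"
      "\<forall>n. \<forall>t\<in>S. (D n has_vector_derivative D (Suc n) t) (at t)" "\<forall>t\<in>S. D 1 t \<noteq> 0" "open S"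
        by blast
    have "jet_lift S \<gamma> D one"
      using D d_one by (auto simp: jet_lift_def S_def one_def proj_def)
    then show ?thesis using t False by (intro exI[of _ S]) (auto simp: S_def)
  next
    case True
    define S where "S = {t \<in> I. \<gamma> t \<in> chart_dom At_Infinity}"
    from ex[OF S_def] obtain D where D: "\<forall>t\<in>S. D 0 t = coord At_Infinity (\<gamma> t)"
      "\<forall>n. \<forall>t\<in>S. (D n has_vector_derivative D (Suc n) t) (at t)" "\<forall>t\<in>S. D 1 t \<noteq> 0" "open S"
        by blast
    have "jet_lift S \<gamma> one D"
      using D d_one by (auto simp: jet_lift_def S_def one_def proj_def split: option.splits)
    then show ?thesis using t True by (intro exI[of _ S]) (auto simp: S_def)
  qed
qed (use reg in \<open>auto simp: regular_parametrisation_def\<close>)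

text \<open>With Wronskian w, the affine velocity is w / v^2 and the affine component of the field
  is Q(u, v) / (2 v^2), so v^2 cancels in the quotient. At infinity both components carry the same
  minus sign.\<close>

lemma tangent_along_imp_tangent_form:
  assumes "tangent_along (ckf a b c) I \<gamma>"
  shows "tangent_form a b c I \<gamma>"
  unfolding tangent_form_def
proof (intro allI impI)
  fix S U V t assume lift: "jet_lift S \<gamma> U V" and t: "t \<in> S \<inter> I"
  define u v w where "u = U 0 t" and "v = V 0 t" and "w = U 1 t * V 0 t - U 0 t * V 1 t"
  have w0: "w \<noteq> 0" and \<gamma>t: "\<gamma> t = proj u v" and uv: "u \<noteq> 0 \<or> v \<noteq> 0"
    using jet_liftD(4-6)[OF lift] t by (auto simp: w_def u_def v_def)
  have "(a * u\<^sup>2 + b * (u * v) + c * v\<^sup>2) / w \<in> \<real>"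
  proof (cases "v = 0")
    case False
    have "velocity Affine \<gamma> t = w / v\<^sup>2"
      using jet_lift_affine_coordinate[OF lift] t False
      by (simp add: velocity_def o_def vector_derivative_at u_def v_def w_def)
    moreover have "ckf a b c Affine (coord Affine (\<gamma> t)) \<in> span {velocity Affine \<gamma> t}"
      using assms t False \<gamma>t unfolding tangent_along_def by (metis IntD2 proj_in_chart_dom(1))
    ultimately have "(a * (u / v)\<^sup>2 + b * (u / v) + c) / 2 \<in> span {(w / v\<^sup>2)}"
      by (simp only: \<gamma>t coord_proj(1)[OF False] ckf.simps)
    then obtain k where "(a * (u / v)\<^sup>2 + b * (u / v) + c) / 2 = k *\<^sub>R (w / v\<^sup>2)"
      unfolding span_singleton by blast
    moreover have "a * u\<^sup>2 + b * (u * v) + c * v\<^sup>2 = 2 * v\<^sup>2 * ((a * (u / v)\<^sup>2 + b * (u / v) + c) / 2)"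
      using False by (simp add: field_simps power2_eq_square)
    ultimately have "(a * u\<^sup>2 + b * (u * v) + c * v\<^sup>2) / w = of_real (2 * k)"
      using False w0 by (simp add: scaleR_conv_of_real)
    then show ?thesis by simp
  next
    case True
    then have u0: "u \<noteq> 0" using uv by simp
    have "velocity At_Infinity \<gamma> t = - (w / u\<^sup>2)"
      using jet_lift_infinity_coordinate[OF lift] t u0
      by (simp add: velocity_def vector_derivative_at u_def v_def w_def mult.commute minus_divide_left)
    moreover have "ckf a b c At_Infinity (coord At_Infinity (\<gamma> t)) \<in> span {velocity At_Infinity \<gamma> t}"
      using assms t u0 \<gamma>t unfolding tangent_along_def by (metis IntD2 proj_in_chart_dom(2))
    ultimately have "- (a + b * (v / u) + c * (v / u)\<^sup>2) / 2 \<in> span {- (w / u\<^sup>2)}"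
      by (simp only: \<gamma>t coord_proj(2)[OF u0] ckf.simps)
    then obtain k where "- (a + b * (v / u) + c * (v / u)\<^sup>2) / 2 = k *\<^sub>R - (w / u\<^sup>2)"
      unfolding span_singleton by blast
    then have "(a * u\<^sup>2 + b * (u * v) + c * v\<^sup>2) / w = of_real (2 * k)"
      using u0 w0 True by (simp add: scaleR_conv_of_real field_simps power2_eq_square)
    then show ?thesis by simp
  qed
  then show "(a * (U 0 t)\<^sup>2 + b * (U 0 t * V 0 t) + c * (V 0 t)\<^sup>2) / (U 1 t * V 0 t - U 0 t * V 1 t) \<in> \<real>"
    by (simp add: u_def v_def w_def)
qed

lemma jet_lift_moebius:
  assumes "p * s - q * r = 1" "jet_lift S \<gamma> U V"
  shows "jet_lift S (moebius_cp1 p q r s \<circ> \<gamma>) (\<lambda>n t. p * U n t + q * V n t) (\<lambda>n t. r * U n t + s * V n t)"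
proof -
  note D = jet_liftD[OF assms(2)]
  have "(p * u1 + q * v1) * (r * u0 + s * v0) - (p * u0 + q * v0) * (r * u1 + s * v1) = u1 * v0 - u0 * v1"
    for u0 u1 v0 v1
  proof -
    have "(p * u1 + q * v1) * (r * u0 + s * v0) - (p * u0 + q * v0) * (r * u1 + s * v1)
      = (p * s - q * r) * (u1 * v0 - u0 * v1)" by algebra
    then show ?thesis using assms by simp
  qed
  then show ?thesis
    using D assms(1) unfolding jet_lift_def
    by (auto simp: moebius_proj intro!: derivative_intros)
qed

lemma smooth_curve_moebius:
  assumes "m \<in> moebius_maps" "smooth_curve I \<gamma>"
  shows "smooth_curve I (m \<circ> \<gamma>)"
proof -
  obtain p q r s where m: "m = moebius_cp1 p q r s" "p * s - q * r = 1"
    using assms(1) by (auto simp: moebius_maps_def)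
  show ?thesis
    using assms(2) jet_lift_moebius[OF m(2)] unfolding smooth_curve_def m(1) by meson
qed

text \<open>A lift of the image curve is pulled back by the inverse matrix. The hypothesis on the
  coefficients carries the quadratic form across, and determinant 1 preserves the Wronskian.\<close>

lemma tangent_form_moebius:
  assumes "p * s - q * r = 1" "tangent_form a b c I \<gamma>"
    and Q: "\<And>u v. a * u\<^sup>2 + b * (u * v) + c * v\<^sup>2 =
      a' * (p * u + q * v)\<^sup>2 + b' * ((p * u + q * v) * (r * u + s * v)) + c' * (r * u + s * v)\<^sup>2"
  shows "tangent_form a' b' c' I (moebius_cp1 p q r s \<circ> \<gamma>)"
  unfolding tangent_form_def
proof (intro allI impI)
  fix S U V t assume lift: "jet_lift S (moebius_cp1 p q r s \<circ> \<gamma>) U V" and t: "t \<in> S \<inter> I"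
  have det: "s * p - (- q) * (- r) = 1" using assms(1) by (simp add: algebra_simps)
  define U' V'
    where "U' n t = s * U n t + (- q) * V n t" and "V' n t = (- r) * U n t + p * V n t" for n t
  have "jet_lift S (moebius_cp1 s (- q) (- r) p \<circ> (moebius_cp1 p q r s \<circ> \<gamma>)) U' V'"
    unfolding U'_def V'_def by (rule jet_lift_moebius[OF det lift])
  moreover have "moebius_cp1 s (- q) (- r) p \<circ> (moebius_cp1 p q r s \<circ> \<gamma>) = \<gamma>"
    using moebius_cp1_inverse(1)[OF assms(1)] by (simp add: fun_eq_iff)
  ultimately have "(a * (U' 0 t)\<^sup>2 + b * (U' 0 t * V' 0 t) + c * (V' 0 t)\<^sup>2) / (U' 1 t * V' 0 t - U' 0 t * V' 1 t) \<in> \<real>"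
    using assms(2) t unfolding tangent_form_def by auto
  moreover have "p * U' n t + q * V' n t = U n t" "r * U' n t + s * V' n t = V n t" for n
  proof -
    have "p * U' n t + q * V' n t = (p * s - q * r) * U n t" "r * U' n t + s * V' n t = (p * s - q * r) * V n t"
      unfolding U'_def V'_def by algebra+
    then show "p * U' n t + q * V' n t = U n t" "r * U' n t + s * V' n t = V n t" using assms(1) by auto
  qed
  moreover have "U' 1 t * V' 0 t - U' 0 t * V' 1 t = (p * s - q * r) * (U 1 t * V 0 t - U 0 t * V 1 t)"
    unfolding U'_def V'_def by algebra
  ultimately show "(a' * (U 0 t)\<^sup>2 + b' * (U 0 t * V 0 t) + c' * (V 0 t)\<^sup>2) / (U 1 t * V 0 t - U 0 t * V 1 t) \<in> \<real>"
    using assms(1) by (simp add: Q)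
qed

lemma smooth_curve_affine_derivative:
  assumes "smooth_curve I \<gamma>" "t \<in> I" "\<gamma> t \<noteq> None"
  obtains D where "((\<lambda>s. the (\<gamma> s)) has_vector_derivative D) (at t)" "D \<noteq> 0"
    "\<And>a b c. tangent_form a b c I \<gamma> \<Longrightarrow> (a * (the (\<gamma> t))\<^sup>2 + b * the (\<gamma> t) + c) / D \<in> \<real>"
proof -
  obtain S U V
    where t: "t \<in> S" and lift: "jet_lift S \<gamma> U V" using smooth_curveE[OF assms(1,2)] by metis
  define u v w where "u = U 0 t" and "v = V 0 t" and "w = U 1 t * V 0 t - U 0 t * V 1 t"
  have w0: "w \<noteq> 0" using jet_liftD(5)[OF lift t] by (simp add: w_def)
  have v0: "v \<noteq> 0" and \<gamma>t: "the (\<gamma> t) = u / v"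
    using jet_liftD(4)[OF lift t] assms(3) by (auto simp: proj_def u_def v_def split: if_splits)
  show ?thesis
  proof (rule that)
    show "((\<lambda>s. the (\<gamma> s)) has_vector_derivative w / v\<^sup>2) (at t)"
      using jet_lift_affine_coordinate[OF lift t] v0 by (simp add: w_def v_def)
    show "w / v\<^sup>2 \<noteq> 0" using w0 v0 by simp
    fix a b c assume "tangent_form a b c I \<gamma>"
    then have "(a * u\<^sup>2 + b * (u * v) + c * v\<^sup>2) / w \<in> \<real>"
      using lift t assms(2) unfolding tangent_form_def u_def v_def w_def by blast
    moreover have "(a * (the (\<gamma> t))\<^sup>2 + b * the (\<gamma> t) + c) / (w / v\<^sup>2) = (a * u\<^sup>2 + b * (u * v) + c * v\<^sup>2) / w"
      using v0 w0 by (simp add: \<gamma>t field_simps power2_eq_square)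
    ultimately show "(a * (the (\<gamma> t))\<^sup>2 + b * the (\<gamma> t) + c) / (w / v\<^sup>2) \<in> \<real>"
      by (simp only:)
  qed
qed

lemma tendsto_difference_quotient:
  fixes f :: "real \<Rightarrow> complex"
  assumes "(f has_vector_derivative f') (at t)"
  shows "((\<lambda>s. (f s - f t) / of_real (s - t)) \<longlongrightarrow> f') (at t)"
proof -
  have "((\<lambda>s. Re (f s)) has_real_derivative Re f') (at t)" "((\<lambda>s. Im (f s)) has_real_derivative Im f') (at t)"
    using assms by (auto simp: has_vector_derivative_complex_iff)
  then show ?thesis
    by (simp add: has_field_derivative_iff tendsto_complex_iff Re_divide_of_real Im_divide_of_real
        del: of_real_diff)
qed

lemma eventually_nonzero_of_derivative:
  fixes f :: "real \<Rightarrow> complex"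
  assumes "(f has_vector_derivative f') (at t)" "f t \<noteq> 0 \<or> f' \<noteq> 0"
  shows "eventually (\<lambda>s. f s \<noteq> 0) (at t)"
proof (cases "f t = 0")
  case False
  have "isCont f t" using assms(1) by (rule has_vector_derivative_continuous)
  then show ?thesis using False by (auto simp: isCont_def intro: tendsto_imp_eventually_ne)
next
  case True
  then have "eventually (\<lambda>s. (f s - f t) / of_real (s - t) \<noteq> 0) (at t)"
    using tendsto_imp_eventually_ne[OF tendsto_difference_quotient[OF assms(1)]] assms(2) by blast
  then show ?thesis by eventually_elim (use True in auto)
qed

text \<open>Where U vanishes the Wronskian reduces to U' V, so the zero of U is simple and hence
  isolated; the same holds for V. The points 0 and infinity are where the normal forms
  \<open>k u v\<close> and \<open>k v^2\<close> have their zeros.\<close>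

lemma smooth_curve_eventually_not_poles:
  assumes "smooth_curve I \<gamma>" "t \<in> I"
  shows "eventually (\<lambda>s. s \<in> I \<and> \<gamma> s \<noteq> None \<and> \<gamma> s \<noteq> Some 0) (at t)"
proof -
  obtain S U V
    where t: "t \<in> S" "S \<subseteq> I" and lift: "jet_lift S \<gamma> U V"
      using smooth_curveE[OF assms] by metis
  note L = jet_liftD[OF lift]
  have "U 0 t \<noteq> 0 \<or> U 1 t \<noteq> 0" "V 0 t \<noteq> 0 \<or> V 1 t \<noteq> 0"
    using L(5)[OF t(1)] by auto
  then have "eventually (\<lambda>s. U 0 s \<noteq> 0) (at t)" "eventually (\<lambda>s. V 0 s \<noteq> 0) (at t)"
    using L(2,3)[OF t(1), of 0] by (auto intro!: eventually_nonzero_of_derivative)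
  moreover have "eventually (\<lambda>s. s \<in> S) (at t)"
    using L(1) t(1) by (auto simp: eventually_at_topological)
  ultimately show ?thesis
    by eventually_elim (use t(2) L(4) in \<open>auto simp: proj_def\<close>)
qed

lemma smooth_curve_eventually_affine:
  assumes "smooth_curve I \<gamma>" "t \<in> I" "\<gamma> t \<noteq> None"
  shows "eventually (\<lambda>s. s \<in> I \<and> \<gamma> s \<noteq> None) (nhds t)"
  using smooth_curve_eventually_not_poles[OF assms(1,2)] assms(2,3)
  by (auto simp: eventually_nhds_conv_at elim: eventually_mono)


section \<open>Osculating circles\<close>

text \<open>The set \<open>A\<close> need only accumulate at \<open>t\<close>, so it may be an
  interval on one side. The derivatives vanish on the open set and reach \<open>t\<close> by
  continuity.\<close>

lemma vanishing_two_jet: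
  fixes f :: "real \<Rightarrow> 'a :: real_normed_vector"
  assumes S: "open S" "t \<in> S" and A: "open A" "t \<in> closure A"
    and d: "\<And>x. x \<in> S \<Longrightarrow> (f has_vector_derivative f1 x) (at x)"
      "\<And>x. x \<in> S \<Longrightarrow> (f1 has_vector_derivative f2 x) (at x)"
      "isCont f2 t"
    and z: "\<And>x. x \<in> A \<inter> S \<Longrightarrow> f x = 0"
  shows "f t = 0 \<and> f1 t = 0 \<and> f2 t = 0"
proof -
  have o: "open (A \<inter> S)" by (rule open_Int[OF A(1) S(1)])
  have cl: "t \<in> closure (A \<inter> S)"
    using open_Int_closure_subset[OF S(1), of A] S(2) A(2) by (auto simp: Int_commute)
  have z1: "f1 x = 0" if "x \<in> A \<inter> S" for x
    using vector_derivative_zero_of_vanishing[OF d(1) o that z] that by auto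
  have z2: "f2 x = 0" if "x \<in> A \<inter> S" for x
    using vector_derivative_zero_of_vanishing[OF d(2) o that z1] that by auto
  have "g t = 0" if g: "isCont g t" "\<And>x. x \<in> A \<inter> S \<Longrightarrow> g x = 0" for g :: "real \<Rightarrow> 'a"
  proof (rule ccontr)
    assume "g t \<noteq> 0"
    then obtain e where "e > 0" "\<And>y. dist t y < e \<Longrightarrow> g y \<noteq> 0"
      using continuous_at_avoid[OF g(1)] by metis
    moreover obtain y where "y \<in> A \<inter> S" "dist y t < e"
      using cl \<open>e > 0\<close> unfolding closure_approachable by blast
    ultimately show False using g(2) by (metis dist_commute)
  qed
  note closed = this
  have "isCont f t" "isCont f1 t"
    using d(1,2)[OF S(2)] by (auto intro: has_vector_derivative_continuous)
  then show ?thesis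
    using closed[of f] closed[of f1] closed[of f2] z z1 z2 d(3) by simp
qed

lemma vanishing_hermitian_two_jet:
  fixes X Y :: "nat \<Rightarrow> real \<Rightarrow> complex"
  assumes S: "open S" "t \<in> S" and A: "open A" "t \<in> closure A"
    and d: "\<And>n x. x \<in> S \<Longrightarrow> (X n has_vector_derivative X (Suc n) x) (at x)"
      "\<And>n x. x \<in> S \<Longrightarrow> (Y n has_vector_derivative Y (Suc n) x) (at x)"
    and z: "\<And>x. x \<in> A \<inter> S \<Longrightarrow> Im (X 0 x * cnj (Y 0 x)) = 0"
  shows "Im (X 0 t * cnj (Y 0 t)) = 0"
    "Im (X 1 t * cnj (Y 0 t) + X 0 t * cnj (Y 1 t)) = 0"
    "Im (X 2 t * cnj (Y 0 t) + 2 * (X 1 t * cnj (Y 1 t)) + X 0 t * cnj (Y 2 t)) = 0"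
proof -
  have dc: "((\<lambda>x. cnj (Y n x)) has_vector_derivative cnj (Y (Suc n) x)) (at x)"
    if "x \<in> S" for n x
    using bounded_linear.has_vector_derivative[OF bounded_linear_cnj d(2)[OF that]] .
  have dI: "((\<lambda>x. Im (f x)) has_vector_derivative Im f') (at x)"
    if "(f has_vector_derivative f') (at x)"
    for f f' and x :: real
    using bounded_linear.has_vector_derivative[OF bounded_linear_Im that] .
  have cont: "isCont (X n) t" "isCont (Y n) t" for n
    using d[OF S(2)] by (auto intro: has_vector_derivative_continuous)
  have "Im (X 0 t * cnj (Y 0 t)) = 0 \<and>
    Im (X 0 t * cnj (Y (Suc 0) t) + X (Suc 0) t * cnj (Y 0 t)) = 0 \<and>
    Im ((X 0 t * cnj (Y (Suc (Suc 0)) t) + X (Suc 0) t * cnj (Y (Suc 0) t)) +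
        (X (Suc 0) t * cnj (Y (Suc 0) t) + X (Suc (Suc 0)) t * cnj (Y 0 t))) = 0"
  proof (rule vanishing_two_jet[OF S A, where f = "\<lambda>x. Im (X 0 x * cnj (Y 0 x))"])
    fix x assume x: "x \<in> S"
    show "((\<lambda>x. Im (X 0 x * cnj (Y 0 x))) has_vector_derivative
        Im (X 0 x * cnj (Y (Suc 0) x) + X (Suc 0) x * cnj (Y 0 x))) (at x)"
      by (intro dI derivative_intros d dc x)
    show "((\<lambda>x. Im (X 0 x * cnj (Y (Suc 0) x) + X (Suc 0) x * cnj (Y 0 x))) has_vector_derivative
        Im ((X 0 x * cnj (Y (Suc (Suc 0)) x) + X (Suc 0) x * cnj (Y (Suc 0) x)) +
        (X (Suc 0) x * cnj (Y (Suc 0) x) + X (Suc (Suc 0)) x * cnj (Y 0 x)))) (at x)"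
      by (intro dI derivative_intros d dc x)
  next
    show "isCont (\<lambda>x. Im ((X 0 x * cnj (Y (Suc (Suc 0)) x) + X (Suc 0) x * cnj (Y (Suc 0) x)) +
        (X (Suc 0) x * cnj (Y (Suc 0) x) + X (Suc (Suc 0)) x * cnj (Y 0 x)))) t"
      by (intro isCont_Im isCont_cnj continuous_add continuous_mult cont)
  qed (rule z)
  then show "Im (X 0 t * cnj (Y 0 t)) = 0"
    "Im (X 1 t * cnj (Y 0 t) + X 0 t * cnj (Y 1 t)) = 0"
    "Im (X 2 t * cnj (Y 0 t) + 2 * (X 1 t * cnj (Y 1 t)) + X 0 t * cnj (Y 2 t)) = 0"
    by (simp_all add: numeral_2_eq_2 algebra_simps)
qed

lemma hermitian_form_expand:
  "(p * u + q * v) * cnj (r * u' + s * v') =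
     p * cnj r * (u * cnj u') + p * cnj s * (u * cnj v') + q * cnj r * (v * cnj u') + q * cnj s * (v * cnj v')"
  by (simp add: algebra_simps)

lemma Im_mult_real: "Im z = 0 \<Longrightarrow> Im (w * z) = Im w * Re z"
  by simp

lemma Im_mult_norm_square: "Im (w * (z * cnj z)) = Im w * (norm z)\<^sup>2"
  unfolding complex_norm_square[symmetric] by simp

text \<open>With the contact point at 0, the Hermitian form of \<open>L\<close> has jets of
  triangular shape: orders 0, 1 and 2 remove one unwanted real coefficient each, and a real multiple
  of Im (u cnj v) remains.\<close>

lemma round_circle_osculating_rp1:
  assumes lift: "jet_lift S \<gamma> U V" "t \<in> S" "\<gamma> t = Some 0"
    and A: "open A" "t \<in> closure A" "\<gamma> ` A \<subseteq> rp1"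
    and B: "open B" "t \<in> closure B" "\<gamma> ` B \<subseteq> L"
    and L: "L \<in> round_circles"
  shows "L = rp1"
proof -
  note J = jet_liftD[OF lift(1)]
  obtain p q r s where form:
    "\<And>u v. u \<noteq> 0 \<or> v \<noteq> 0 \<Longrightarrow> proj u v \<in> L \<longleftrightarrow> Im ((p * u + q * v) * cnj (r * u + s * v)) = 0"
    using round_circle_form[OF L] by metis
  have U0: "U 0 t = 0" and V0: "V 0 t \<noteq> 0"
    using J(4)[OF lift(2)] J(6)[OF lift(2)] lift(3) by (auto simp: proj_def split: if_splits)
  have U1: "U 1 t \<noteq> 0" using J(5)[OF lift(2)] U0 by auto
  have "Im (U 0 x * cnj (V 0 x)) = 0" if "x \<in> A \<inter> S" for x
    using rp1_proj[OF J(6)] J(4) A(3) that by (auto simp: image_subset_iff)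
  from vanishing_hermitian_two_jet[where X = U and Y = V, OF J(1) lift(2) A(1,2) J(2,3) this]
  have real: "Im (U 1 t * cnj (V 0 t)) = 0" "Im (U 2 t * cnj (V 0 t) + 2 * (U 1 t * cnj (V 1 t))) = 0"
    unfolding U0 by simp_all
  define X Y where "X n x = p * U n x + q * V n x" and "Y n x = r * U n x + s * V n x" for n x
  have dX: "(X n has_vector_derivative X (Suc n) x) (at x)" if "x \<in> S" for n x
    unfolding X_def by (intro derivative_intros J that)
  have dY: "(Y n has_vector_derivative Y (Suc n) x) (at x)" if "x \<in> S" for n x
    unfolding Y_def by (intro derivative_intros J that)
  have "Im (X 0 x * cnj (Y 0 x)) = 0" if "x \<in> B \<inter> S" for x
    unfolding X_def Y_def using form[OF J(6)] J(4) B(3) that by (auto simp: image_subset_iff)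
  from vanishing_hermitian_two_jet[where X = X and Y = Y, OF J(1) lift(2) B(1,2) dX dY this]
  have jets: "Im (X 0 t * cnj (Y 0 t)) = 0"
    "Im (X 1 t * cnj (Y 0 t) + X 0 t * cnj (Y 1 t)) = 0"
    "Im (X 2 t * cnj (Y 0 t) + 2 * (X 1 t * cnj (Y 1 t)) + X 0 t * cnj (Y 2 t)) = 0" by blast+
  \<comment> \<open>First- and second-order data of the curve at 0, both real because the curve runs
    in \<open>rp1\<close> along \<open>A\<close>.\<close>
  define x where "x = U 1 t * cnj (V 0 t)"
  define y where "y = U 2 t * cnj (V 0 t) + 2 * (U 1 t * cnj (V 1 t))"
  have x: "Im x = 0" "x \<noteq> 0" and y: "Im y = 0" using real U1 V0 by (auto simp: x_def y_def)
  have z1: "Im (q * cnj s) = 0"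
  proof -
    have "X 0 t * cnj (Y 0 t) = q * cnj s * (V 0 t * cnj (V 0 t))" by (simp add: X_def Y_def U0)
    then have "Im (q * cnj s * (V 0 t * cnj (V 0 t))) = 0" using jets(1) by (simp only:)
    then show ?thesis using V0 by (simp only: Im_mult_norm_square) simp
  qed
  have z2: "Im (p * cnj s + q * cnj r) = 0"
  proof -
    have "X 1 t * cnj (Y 0 t) + X 0 t * cnj (Y 1 t) = p * cnj s * x + q * cnj r * cnj x
        + q * cnj s * (V 1 t * cnj (V 0 t) + V 0 t * cnj (V 1 t))"
      by (simp add: X_def Y_def hermitian_form_expand U0 x_def algebra_simps)
    moreover have "Im (V 1 t * cnj (V 0 t) + V 0 t * cnj (V 1 t)) = 0" by simp
    ultimately have "Im (p * cnj s * x + q * cnj r * cnj x) = 0"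
      using jets(2) z1 by (simp only: plus_complex.sel Im_mult_real mult_zero_left add_0_right)
    moreover have "cnj x = x" using x by (simp add: complex_eq_iff)
    ultimately have "Im ((p * cnj s + q * cnj r) * x) = 0" by (simp add: distrib_right)
    then have "Im (p * cnj s + q * cnj r) * Re x = 0" by (simp only: Im_mult_real[OF x(1)])
    then show ?thesis using x by (auto simp: complex_eq_iff)
  qed
  \<comment> \<open>The remaining coefficient is multiplied by |U'|^2, which is nonzero because the
    curve is immersed.\<close>
  have z3: "Im (p * cnj r) = 0"
  proof -
    have "X 2 t * cnj (Y 0 t) + 2 * (X 1 t * cnj (Y 1 t)) + X 0 t * cnj (Y 2 t) =
        p * cnj s * y + q * cnj r * cnj y + p * cnj r * (2 * (U 1 t * cnj (U 1 t)))
        + q * cnj s * (V 2 t * cnj (V 0 t) + 2 * (V 1 t * cnj (V 1 t)) + V 0 t * cnj (V 2 t))"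
      by (simp add: X_def Y_def hermitian_form_expand U0 y_def algebra_simps)
    moreover have "Im (V 2 t * cnj (V 0 t) + 2 * (V 1 t * cnj (V 1 t)) + V 0 t * cnj (V 2 t)) = 0"
      by simp
    ultimately have "Im (p * cnj s * y + q * cnj r * cnj y) + Im (p * cnj r * (2 * (U 1 t * cnj (U 1 t)))) = 0"
      using jets(3) z1 by (simp only: plus_complex.sel Im_mult_real mult_zero_left add_0_right)
    moreover have "cnj y = y" using y by (simp add: complex_eq_iff)
    ultimately have "Im ((p * cnj s + q * cnj r) * y) + Im (p * cnj r * (2 * (U 1 t * cnj (U 1 t)))) = 0"
      by (simp add: distrib_right)
    then have "Im (p * cnj r * (2 * (U 1 t * cnj (U 1 t)))) = 0"
      by (simp only: Im_mult_real[OF y] z2 mult_zero_left add_0)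
    then have "Im (2 * (p * cnj r) * (U 1 t * cnj (U 1 t))) = 0" by (simp only: mult_ac)
    then show ?thesis using U1 by (simp only: Im_mult_norm_square) simp
  qed
  define k where "k = Re (p * cnj s - q * cnj r)"
  have form': "proj u v \<in> L \<longleftrightarrow> k * Im (u * cnj v) = 0"
    if "u \<noteq> 0 \<or> v \<noteq> 0" for u v
  proof -
    have "Im (p * cnj r * (u * cnj u)) = 0" "Im (q * cnj s * (v * cnj v)) = 0"
      using z1 z3 by (simp_all only: Im_mult_norm_square mult_zero_left)
    moreover have "Im (p * cnj s * (u * cnj v) + q * cnj r * (v * cnj u)) =
        k * Im (u * cnj v) + Im (p * cnj s + q * cnj r) * Re (u * cnj v)"
      by (simp add: k_def algebra_simps)
    ultimately have "Im ((p * u + q * v) * cnj (r * u + s * v)) = k * Im (u * cnj v)"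
      using z2 by (simp only: hermitian_form_expand plus_complex.sel)
    then show ?thesis using form[OF that] by simp
  qed
  \<comment> \<open>Otherwise the form would vanish identically and \<open>L\<close> would be the
    whole sphere.\<close>
  have "k \<noteq> 0"
  proof
    assume "k = 0"
    then have "x \<in> L" for x using form' proj_exhaust[of x] by (metis mult_zero_left)
    then show False using round_circle_proper[OF L] by blast
  qed
  then have "x \<in> L \<longleftrightarrow> x \<in> rp1" for x
    using proj_exhaust[of x] form' rp1_proj by (metis mult_eq_0_iff)
  then show ?thesis by blast
qed

lemma round_circle_closed_along:
  assumes lift: "jet_lift S \<gamma> U V" "t \<in> S"
    and A: "open A" "t \<in> closure A" "\<gamma> ` A \<subseteq> L" and L: "L \<in> round_circles"
  shows "\<gamma> t \<in> L"
proof -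
  note J = jet_liftD[OF lift(1)]
  obtain p q r s where form:
    "\<And>u v. u \<noteq> 0 \<or> v \<noteq> 0 \<Longrightarrow> proj u v \<in> L \<longleftrightarrow> Im ((p * u + q * v) * cnj (r * u + s * v)) = 0"
    using round_circle_form[OF L] by metis
  define X Y where "X n x = p * U n x + q * V n x" and "Y n x = r * U n x + s * V n x" for n x
  have dX: "(X n has_vector_derivative X (Suc n) x) (at x)" if "x \<in> S" for n x
    unfolding X_def by (intro derivative_intros J that)
  have dY: "(Y n has_vector_derivative Y (Suc n) x) (at x)" if "x \<in> S" for n x
    unfolding Y_def by (intro derivative_intros J that)
  have "Im (X 0 x * cnj (Y 0 x)) = 0" if "x \<in> A \<inter> S" for x
    unfolding X_def Y_def using form[OF J(6)] J(4) A(3) that by (auto simp: image_subset_iff)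
  from vanishing_hermitian_two_jet(1)[where X = X and Y = Y, OF J(1) lift(2) A(1,2) dX dY this]
  show ?thesis using form[OF J(6)[OF lift(2)]] J(4)[OF lift(2)] by (simp add: X_def Y_def)
qed

text \<open>\<open>A\<close> and \<open>B\<close> may lie on different sides of \<open>t\<close>.
  The common limit point lies on \<open>L\<close>, so a Moebius map turns \<open>L\<close> into
  \<open>rp1\<close> with contact point 0.\<close>

lemma round_circle_unique:
  assumes \<gamma>: "smooth_curve I \<gamma>" "t \<in> I"
    and A: "open A" "t \<in> closure A" "\<gamma> ` A \<subseteq> L" and L: "L \<in> round_circles"
    and B: "open B" "t \<in> closure B" "\<gamma> ` B \<subseteq> L'" and L': "L' \<in> round_circles"
  shows "L = L'"
proof -
  obtain S U V
    where lift: "t \<in> S" "jet_lift S \<gamma> U V" using smooth_curveE[OF \<gamma>] by metis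
  have "\<gamma> t \<in> L" by (rule round_circle_closed_along[OF lift(2,1) A L])
  then obtain m where m: "m \<in> moebius_maps" "L = m ` rp1" "\<gamma> t = m (Some 0)"
    by (rule round_circle_with_base_point[OF L])
  obtain n where n: "n \<in> moebius_maps" "\<And>x. m (n x) = x" "\<And>x. n (m x) = x"
    using moebius_maps_inverse[OF m(1)] by metis
  obtain S U V where lift: "t \<in> S" "jet_lift S (n \<circ> \<gamma>) U V"
    using smooth_curveE[OF smooth_curve_moebius[OF n(1) \<gamma>(1)] \<gamma>(2)] by metis
  have "n ` L' = rp1"
  proof (rule round_circle_osculating_rp1[OF lift(2,1) _ A(1,2) _ B(1,2)])
    show "(n \<circ> \<gamma>) t = Some 0" using m n by simp
    show "(n \<circ> \<gamma>) ` A \<subseteq> rp1" using A(3) m(2) n by fastforce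
    show "(n \<circ> \<gamma>) ` B \<subseteq> n ` L'" using B(3) by auto
    show "n ` L' \<in> round_circles" by (rule moebius_image_round_circles[OF n(1) L'])
  qed
  then have "m ` n ` L' = L" using m by simp
  then show ?thesis using n(2) by (simp add: image_image)
qed

section \<open>From local circles to one circle\<close>

definition locally_circular :: "(real \<Rightarrow> cp1) \<Rightarrow> real \<Rightarrow> bool" where
  "locally_circular \<gamma> t \<longleftrightarrow> (\<exists>L\<in>round_circles. eventually (\<lambda>s. \<gamma> s \<in> L) (nhds t))"

text \<open>Circles chosen at neighbouring parameters contain a common arc of the curve and hence
  agree, so the choice is locally constant on the connected set \<open>J\<close>.\<close>

lemma locally_circular_imp_circular:
  assumes \<gamma>: "smooth_curve I \<gamma>" and J: "J \<subseteq> I" "connected J" "J \<noteq> {}"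
    and loc: "\<And>t. t \<in> J \<Longrightarrow> locally_circular \<gamma> t"
  obtains L where "L \<in> round_circles" "\<gamma> ` J \<subseteq> L"
proof -
  have unique: "L = L'" if h: "t \<in> I" "L \<in> round_circles" "L' \<in> round_circles"
    "eventually (\<lambda>s. \<gamma> s \<in> L) (nhds t)" "eventually (\<lambda>s. \<gamma> s \<in> L') (nhds t)" for t L L'
  proof -
    obtain A where "open A" "t \<in> A" "\<gamma> ` A \<subseteq> L"
      using h(4) by (auto simp: eventually_nhds)
    moreover obtain B
      where "open B" "t \<in> B" "\<gamma> ` B \<subseteq> L'" using h(5) by (auto simp: eventually_nhds)
    ultimately show ?thesis
      using round_circle_unique[OF \<gamma> h(1), of A L B L'] h(2,3) closure_subset by blast
  qed
  have "\<exists>\<Lambda>. \<forall>t\<in>J. \<Lambda> t \<in> round_circles \<and> eventually (\<lambda>s. \<gamma> s \<in> \<Lambda> t) (nhds t)"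
    using loc unfolding locally_circular_def by (intro bchoice) blast
  then obtain \<Lambda>
    where \<Lambda>: "\<And>t. t \<in> J \<Longrightarrow> \<Lambda> t \<in> round_circles"
    "\<And>t. t \<in> J \<Longrightarrow> eventually (\<lambda>s. \<gamma> s \<in> \<Lambda> t) (nhds t)"
      by blast
  obtain t0 where t0: "t0 \<in> J" using J by blast
  have "\<Lambda> t0 = \<Lambda> t" if "t \<in> J" for t
  proof (rule connected_local_const[OF J(2) t0 that], intro ballI)
    fix a assume a: "a \<in> J"
    have "eventually (\<lambda>b. eventually (\<lambda>s. \<gamma> s \<in> \<Lambda> a) (nhds b)) (nhds a)"
      using \<Lambda>(2)[OF a] by (simp add: eventually_eventually)
    then have "eventually (\<lambda>b. b \<in> J \<longrightarrow> \<Lambda> a = \<Lambda> b) (nhds a)"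
      by eventually_elim (use unique \<Lambda> a J in blast)
    then show "eventually (\<lambda>b. \<Lambda> a = \<Lambda> b) (at a within J)"
      by (auto simp: eventually_at_filter elim: eventually_mono)
  qed
  moreover have "\<gamma> t \<in> \<Lambda> t"
    if "t \<in> J" for t using \<Lambda>(2)[OF that] by (rule eventually_nhds_x_imp_x)
  ultimately show ?thesis using that[of "\<Lambda> t0"] \<Lambda>(1)[OF t0] by fastforce
qed

text \<open>At an isolated exceptional point the two one-sided circles agree because a circle is
  determined by the 2-jet of a regular curve in it.\<close>

lemma circular_of_punctured:
  assumes \<gamma>: "smooth_curve I \<gamma>"
    and loc: "\<And>t. t \<in> I \<Longrightarrow> eventually (locally_circular \<gamma>) (at t)"
  obtains L where "L \<in> round_circles" "\<gamma> ` I \<subseteq> L"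
proof -
  have I: "open I" "connected I" "I \<noteq> {}" using \<gamma> by (auto simp: smooth_curve_def)
  have "locally_circular \<gamma> t" if t: "t \<in> I" for t
  proof -
    obtain d where d: "d > 0" "\<And>s. s \<noteq> t \<Longrightarrow> dist s t < d \<Longrightarrow> locally_circular \<gamma> s"
      using loc[OF t] by (auto simp: eventually_at)
    obtain d' where d': "d' > 0" "ball t d' \<subseteq> I" using I(1) t by (meson open_contains_ball)
    define e where "e = min d d'"
    have e: "e > 0" "ball t e \<subseteq> I" "\<And>s. s \<noteq> t \<Longrightarrow> s \<in> ball t e \<Longrightarrow> locally_circular \<gamma> s"
      using d d' by (auto simp: e_def dist_commute)
    have ball: "{t - e<..<t + e} = ball t e" by (auto simp: dist_real_def)
    obtain L where L: "L \<in> round_circles" "\<gamma> ` {t<..<t + e} \<subseteq> L"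
      by (rule locally_circular_imp_circular[OF \<gamma>, of "{t<..<t + e}"])
        (use e in \<open>auto simp flip: ball\<close>)
    obtain L' where L': "L' \<in> round_circles" "\<gamma> ` {t - e<..<t} \<subseteq> L'"
      by (rule locally_circular_imp_circular[OF \<gamma>, of "{t - e<..<t}"])
        (use e in \<open>auto simp flip: ball\<close>)
    have cl: "t \<in> closure {t<..<t + e}" "t \<in> closure {t - e<..<t}" using e(1) by auto
    have "L = L'" by (rule round_circle_unique[OF \<gamma> t _ cl(1) L(2,1) _ cl(2) L'(2,1)]) auto
    moreover have "\<gamma> t \<in> L"
    proof -
      obtain S U V
        where "t \<in> S" "jet_lift S \<gamma> U V" using smooth_curveE[OF \<gamma> t] by metis
      then show ?thesis using round_circle_closed_along[OF _ _ _ cl(1) L(2,1)] by auto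
    qed
    ultimately have "\<gamma> s \<in> L" if "s \<in> ball t e" for s
      using L(2) L'(2) that unfolding ball[symmetric] by (cases s t rule: linorder_cases) auto
    moreover have "eventually (\<lambda>s. s \<in> ball t e) (nhds t)"
      using e(1) by (intro eventually_nhds_in_open) auto
    ultimately have "eventually (\<lambda>s. \<gamma> s \<in> L) (nhds t)" by (simp add: eventually_mono)
    then show ?thesis using L(1) unfolding locally_circular_def by blast
  qed
  then show ?thesis using locally_circular_imp_circular[OF \<gamma> _ I(2,3)] that by blast
qed


section \<open>Integral curves of conformal Killing fields\<close>

text \<open>The linear factors of the form become the new coordinates, scaled to determinant 1. A
  double root leaves a square, and the other row of the matrix is then free apart from the
  determinant.\<close>

lemma quadratic_normal_form:
  fixes a b c :: complex
  assumes "a \<noteq> 0 \<or> b \<noteq> 0 \<or> c \<noteq> 0"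
  obtains p q r s k where "p * s - q * r = 1" "k \<noteq> 0"
    "(\<forall>u v. a * u\<^sup>2 + b * (u * v) + c * v\<^sup>2 = k * ((p * u + q * v) * (r * u + s * v))) \<or>
     (\<forall>u v. a * u\<^sup>2 + b * (u * v) + c * v\<^sup>2 = k * (r * u + s * v)\<^sup>2)"
proof (cases "a = 0")
  case a: False
  define d where "d = csqrt (b\<^sup>2 - 4 * a * c)"
  have d2: "d\<^sup>2 = b\<^sup>2 - 4 * a * c" by (simp add: d_def)
  show ?thesis
  proof (cases "d = 0")
    case False
    define z1 z2 where "z1 = (- b + d) / (2 * a)" and "z2 = (- b - d) / (2 * a)"
    have z: "a * z1 + a * z2 = - b" "a * z1 - a * z2 = d"
      using a by (auto simp: z1_def z2_def field_simps)
    have "4 * a * (a * z1 * z2) = 4 * a * c"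
      using z d2 by algebra
    then have zz: "a * z1 * z2 = c" using a by simp
    show ?thesis
    \<comment> \<open>In order of occurrence the arguments are p, s, q, r, k. The rows are (a / d)
      (u - z1 v) and u - z2 v, with determinant a (z1 - z2) / d = 1; the compensating factor is k =
      d.\<close>
    proof (rule that[of "a / d" "- z2" "- a * z1 / d" 1 d])
      show "a / d * - z2 - - a * z1 / d * 1 = 1" using z False by (simp add: field_simps)
      have e: "d * (a / d * u + - a * z1 / d * v) = a * u - a * z1 * v" for u v
        using False by (simp add: right_diff_distrib)
      have "a * u\<^sup>2 + b * (u * v) + c * v\<^sup>2 = (a * u - a * z1 * v) * (1 * u + - z2 * v)" for u v
        using z(1) zz by algebra
      then have "a * u\<^sup>2 + b * (u * v) + c * v\<^sup>2 =
          d * ((a / d * u + - a * z1 / d * v) * (1 * u + - z2 * v))" for u v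
        by (simp only: mult.assoc[of d, symmetric] e)
      then show "(\<forall>u v. a * u\<^sup>2 + b * (u * v) + c * v\<^sup>2 =
          d * ((a / d * u + - a * z1 / d * v) * (1 * u + - z2 * v))) \<or>
        (\<forall>u v. a * u\<^sup>2 + b * (u * v) + c * v\<^sup>2 = d * (1 * u + - z2 * v)\<^sup>2)" by blast
    qed (use False in auto)
  next
    case True
    define z1 where "z1 = - b / (2 * a)"
    have z: "2 * a * z1 = - b" using a by (simp add: z1_def)
    have "4 * a * (a * z1 * z1) = 4 * a * c"
      using z d2 True by algebra
    then have zz: "a * z1 * z1 = c" using a by simp
    show ?thesis
    proof (rule that[of 0 "- z1" "- 1" 1 a])
      have "a * u\<^sup>2 + b * (u * v) + c * v\<^sup>2 = a * (1 * u + - z1 * v)\<^sup>2" for u v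
        using z zz by algebra
      then show "(\<forall>u v. a * u\<^sup>2 + b * (u * v) + c * v\<^sup>2 = a * ((0 * u + - 1 * v) * (1 * u + - z1 * v))) \<or>
        (\<forall>u v. a * u\<^sup>2 + b * (u * v) + c * v\<^sup>2 = a * (1 * u + - z1 * v)\<^sup>2)" by blast
    qed (use a in auto)
  qed
next
  case a: True
  show ?thesis
  proof (cases "b = 0")
    case False
    show ?thesis
      by (rule that[of 1 1 "c / b" 0 b]) (use a False in \<open>auto simp: field_simps power2_eq_square\<close>)
  next
    case True
    show ?thesis
      by (rule that[of 1 1 0 0 c]) (use a True assms in auto)
  qed
qed

lemma line_subset_round_circle:
  assumes "d \<noteq> 0"
  obtains L
    where "L \<in> round_circles" "\<And>x. x \<in> \<real> \<Longrightarrow> Some (z + d * x) \<in> L"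
proof (rule that)
  show "moebius_cp1 d z 0 1 ` rp1 \<in> round_circles"
    unfolding round_circles_def using moebius_maps_of_det[of d 1 z 0] assms by auto
  fix x :: complex assume "x \<in> \<real>"
  then show "Some (z + d * x) \<in> moebius_cp1 d z 0 1 ` rp1"
    by (intro image_eqI[of _ _ "Some x"]) (auto simp: moebius_cp1_def moebius_def rp1_def)
qed

lemma centred_circle_subset_round_circle:
  fixes z :: complex
  assumes "z \<noteq> 0"
  obtains L where "L \<in> round_circles" "\<And>w. norm w = norm z \<Longrightarrow> Some w \<in> L"
proof -
  \<comment> \<open>The matrix of the Cayley transform w -> i (z + w) / (z - w), which takes the
    circle |w| = |z| to the real line.\<close>
  have "\<i> * z - \<i> * z * (- 1) \<noteq> 0" using assms by simp
  from round_circle_of_form[OF this] obtain L where L: "L \<in> round_circles"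
    "\<And>u v. u \<noteq> 0 \<or> v \<noteq> 0 \<Longrightarrow> Im ((\<i> * u + \<i> * z * v) * cnj (- 1 * u + z * v)) = 0 \<Longrightarrow> proj u v \<in> L"
    by metis
  have "Some w \<in> L" if "norm w = norm z" for w
  proof -
    have "(Re w)\<^sup>2 + (Im w)\<^sup>2 = (Re z)\<^sup>2 + (Im z)\<^sup>2"
      unfolding cmod_power2[symmetric] using that by simp
    then have "Im ((\<i> * w + \<i> * z * 1) * cnj (- 1 * w + z * 1)) = 0"
      by (simp add: algebra_simps power2_eq_square)
    then show ?thesis using L(2)[of w 1] by (simp add: proj_def)
  qed
  then show ?thesis using that L(1) by blast
qed

section \<open>Integrating the tangency condition\<close>

lemma real_multiple_of_real_derivative:
  fixes F :: "real \<Rightarrow> complex"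
  assumes d: "\<And>s. s \<in> ball t e \<Longrightarrow> (F has_vector_derivative F' s) (at s)"
    and r: "\<And>s. s \<in> ball t e \<Longrightarrow> F' s / k \<in> \<real>"
    and 0: "F t = 0" and s: "s \<in> ball t e"
  shows "F s / k \<in> \<real>"
proof -
  have "((\<lambda>s. Im (F s / k)) has_vector_derivative 0) (at x within ball t e)"
    if "x \<in> ball t e" for x
  proof -
    have "((\<lambda>s. F s / k) has_vector_derivative F' x / k) (at x)"
      by (rule has_vector_derivative_divide[OF d[OF that]])
    from bounded_linear.has_vector_derivative[OF bounded_linear_Im this]
    have "((\<lambda>s. Im (F s / k)) has_vector_derivative 0) (at x)"
      using r[OF that] by (simp add: complex_is_Real_iff)
    then show ?thesis by (rule has_vector_derivative_at_within)
  qed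
  from has_vector_derivative_zero_constant[OF convex_ball this]
  obtain c where c: "\<And>x. x \<in> ball t e \<Longrightarrow> Im (F x / k) = c" by blast
  have "t \<in> ball t e" using s by (auto intro: le_less_trans[OF zero_le_dist])
  then have "c = 0" using c[of t] 0 by simp
  then show ?thesis using c[OF s] by (simp add: complex_is_Real_iff)
qed

lemma inverse_in_Reals: "x / y \<in> \<real> \<Longrightarrow> y / x \<in> (\<real> :: complex set)"
  by (metis Reals_inverse inverse_divide)

text \<open>Tangency to the field of k u v makes z' / z a real multiple of k, so integration makes
  Ln (z / z0) / k real. This value is the flow time \<open>x\<close>.\<close>

lemma linear_flow_local:
  assumes \<gamma>: "smooth_curve I \<gamma>" "tangent_form 0 k 0 I \<gamma>" "t \<in> I"
    and z0: "\<gamma> t = Some z0" "z0 \<noteq> 0" and k: "k \<noteq> 0"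
  shows "eventually (\<lambda>s. \<exists>x::real. \<gamma> s = Some (z0 * exp (k * of_real x))) (nhds t)"
proof -
  define z where "z s = the (\<gamma> s)" for s
  have "\<forall>s. \<exists>D. s \<in> I \<and> \<gamma> s \<noteq> None \<longrightarrow> (z has_vector_derivative D) (at s) \<and> k * z s / D \<in> \<real>"
  proof
    fix s
    show "\<exists>D. s \<in> I \<and> \<gamma> s \<noteq> None \<longrightarrow> (z has_vector_derivative D) (at s) \<and> k * z s / D \<in> \<real>"
    proof (cases "s \<in> I \<and> \<gamma> s \<noteq> None")
      case True
      then obtain D where "((\<lambda>s. the (\<gamma> s)) has_vector_derivative D) (at s)"
        "\<And>a b c. tangent_form a b c I \<gamma> \<Longrightarrow> (a * (the (\<gamma> s))\<^sup>2 + b * the (\<gamma> s) + c) / D \<in> \<real>"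
        using smooth_curve_affine_derivative[OF \<gamma>(1)] by metis
      then show ?thesis using \<gamma>(2) unfolding z_def[abs_def] by force
    qed auto
  qed
  then obtain D
    where D: "\<And>s. s \<in> I \<Longrightarrow> \<gamma> s \<noteq> None \<Longrightarrow> (z has_vector_derivative D s) (at s)"
    "\<And>s. s \<in> I \<Longrightarrow> \<gamma> s \<noteq> None \<Longrightarrow> k * z s / D s \<in> \<real>"
      by metis
  have zt: "z t = z0" by (simp add: z_def z0)
  have "isCont z t" using D(1)[OF \<gamma>(3)] z0 by (auto intro: has_vector_derivative_continuous)
  then have "isCont (\<lambda>s. Re (z s / z0)) t"
    using z0(2) by (intro isCont_Re isCont_divide continuous_const)
  then have "((\<lambda>s. Re (z s / z0)) \<longlongrightarrow> Re (z t / z0)) (nhds t)"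
    unfolding isCont_def
    by (rule tendsto_at_iff_tendsto_nhds[where g = "\<lambda>s. Re (z s / z0)", THEN iffD1])
  then have "((\<lambda>s. Re (z s / z0)) \<longlongrightarrow> 1) (nhds t)" using z0(2) zt by simp
  \<comment> \<open>The quotient stays in the right half-plane, where the principal logarithm is
    holomorphic.\<close>
  then have "eventually (\<lambda>s. Re (z s / z0) > 0) (nhds t)" by (rule order_tendstoD) simp
  moreover have "eventually (\<lambda>s. s \<in> I \<and> \<gamma> s \<noteq> None) (nhds t)"
    by (rule smooth_curve_eventually_affine[OF \<gamma>(1,3)]) (simp add: z0)
  ultimately have "eventually (\<lambda>s. s \<in> I \<and> \<gamma> s \<noteq> None \<and> Re (z s / z0) > 0) (nhds t)"
    by eventually_elim simp
  then obtain e
    where e: "e > 0" "\<And>s. s \<in> ball t e \<Longrightarrow> s \<in> I \<and> \<gamma> s \<noteq> None \<and> Re (z s / z0) > 0"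
    by (auto simp: eventually_nhds_metric dist_commute)
  have "\<exists>x::real. \<gamma> s = Some (z0 * exp (k * of_real x))" if s: "s \<in> ball t e" for s
  proof -
    have "Ln (z s / z0) / k \<in> \<real>"
    proof (rule real_multiple_of_real_derivative[OF _ _ _ s, where F' = "\<lambda>x. D x / z x"])
      fix x assume x: "x \<in> ball t e"
      have nz: "z x \<noteq> 0" and "z x / z0 \<notin> \<real>\<^sub>\<le>\<^sub>0"
        using e(2)[OF x] by (auto simp: complex_nonpos_Reals_iff)
      then have "(Ln has_field_derivative inverse (z x / z0)) (at (z x / z0))"
        by (intro has_field_derivative_Ln)
      from field_vector_diff_chain_at[OF has_vector_derivative_divide[OF D(1)] this] e(2)[OF x]
      show "((\<lambda>s. Ln (z s / z0)) has_vector_derivative D x / z x) (at x)"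
        using z0 nz by (simp add: o_def)
      have "D x / (k * z x) \<in> \<real>" by (rule inverse_in_Reals, rule D(2)) (use e(2)[OF x] in auto)
      then show "D x / z x / k \<in> \<real>" by (simp add: mult.commute)
    qed (use zt z0 in simp)
    then obtain x where "Ln (z s / z0) / k = complex_of_real x" by (auto elim: Reals_cases)
    then have "Ln (z s / z0) = k * of_real x" using k by (simp add: field_simps)
    moreover have "z s / z0 \<noteq> 0" using e(2)[OF s] by auto
    ultimately have "z s / z0 = exp (k * of_real x)" by (metis exp_Ln)
    then have "z s = z0 * exp (k * of_real x)" using z0 by (simp add: field_simps)
    then show ?thesis using e(2)[OF s] by (auto simp: z_def)
  qed
  moreover have "eventually (\<lambda>s. s \<in> ball t e) (nhds t)"
    using e(1) by (intro eventually_nhds_in_open) auto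
  ultimately show ?thesis by (auto elim: eventually_mono)
qed

lemma translation_flow_local:
  assumes \<gamma>: "smooth_curve I \<gamma>" "tangent_form 0 0 k I \<gamma>" "t \<in> I"
    and z0: "\<gamma> t = Some z0" and k: "k \<noteq> 0"
  shows "eventually (\<lambda>s. \<exists>x::real. \<gamma> s = Some (z0 + k * of_real x)) (nhds t)"
proof -
  define z where "z s = the (\<gamma> s)" for s
  have "eventually (\<lambda>s. s \<in> I \<and> \<gamma> s \<noteq> None) (nhds t)"
    by (rule smooth_curve_eventually_affine[OF \<gamma>(1,3)]) (simp add: z0)
  then obtain e
    where e: "e > 0" "\<And>s. s \<in> ball t e \<Longrightarrow> s \<in> I \<and> \<gamma> s \<noteq> None"
    by (auto simp: eventually_nhds_metric dist_commute)
  have "\<exists>D. (z has_vector_derivative D) (at s) \<and> k / D \<in> \<real>" if h: "s \<in> ball t e" for s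
  proof -
    obtain D where "((\<lambda>s. the (\<gamma> s)) has_vector_derivative D) (at s)"
      "\<And>a b c. tangent_form a b c I \<gamma> \<Longrightarrow> (a * (the (\<gamma> s))\<^sup>2 + b * the (\<gamma> s) + c) / D \<in> \<real>"
      using smooth_curve_affine_derivative[OF \<gamma>(1)] e(2)[OF h] by metis
    then show ?thesis using \<gamma>(2) unfolding z_def[abs_def] by force
  qed
  then obtain D
    where D: "\<And>s. s \<in> ball t e \<Longrightarrow> (z has_vector_derivative D s) (at s)"
    "\<And>s. s \<in> ball t e \<Longrightarrow> k / D s \<in> \<real>" by metis
  have "\<exists>x::real. \<gamma> s = Some (z0 + k * of_real x)" if s: "s \<in> ball t e" for s
  proof -
    have "(z s - z0) / k \<in> \<real>"
    proof (rule real_multiple_of_real_derivative[OF _ _ _ s, where F' = D])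
      fix x assume x: "x \<in> ball t e"
      show "((\<lambda>s. z s - z0) has_vector_derivative D x) (at x)"
        using has_vector_derivative_diff[OF D(1)[OF x] has_vector_derivative_const] by simp
      show "D x / k \<in> \<real>" by (rule inverse_in_Reals[OF D(2)[OF x]])
    qed (simp add: z_def z0)
    then obtain x where "(z s - z0) / k = complex_of_real x" by (auto elim: Reals_cases)
    then have "z s = z0 + k * of_real x" using k by (simp add: field_simps)
    then show ?thesis using e(2)[OF s] by (auto simp: z_def)
  qed
  moreover have "eventually (\<lambda>s. s \<in> ball t e) (nhds t)"
    using e(1) by (intro eventually_nhds_in_open) auto
  ultimately show ?thesis by (auto elim: eventually_mono)
qed

text \<open>Away from 0 and infinity the local orbits are pieces of lines in direction k, of circles
  about 0 (Re k = 0), or of rays from 0 (Im k = 0). The excluded parameters are isolated and are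
  filled in by the punctured version of the gluing argument.\<close>

lemma flow_curve_circular:
  assumes \<gamma>: "smooth_curve I \<gamma>" and k: "k \<noteq> 0"
    and Q: "tangent_form 0 0 k I \<gamma> \<or> tangent_form 0 k 0 I \<gamma> \<and> (Re k = 0 \<or> Im k = 0)"
  obtains L where "L \<in> round_circles" "\<gamma> ` I \<subseteq> L"
proof (rule circular_of_punctured[OF \<gamma>])
  fix t assume "t \<in> I"
  show "eventually (locally_circular \<gamma>) (at t)"
    using smooth_curve_eventually_not_poles[OF \<gamma> \<open>t \<in> I\<close>]
  proof eventually_elim
    case (elim s)
    then obtain z where z: "\<gamma> s = Some z" "z \<noteq> 0" "s \<in> I" by auto
    from Q show ?case
    proof (elim disjE conjE)
      assume "tangent_form 0 0 k I \<gamma>"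
      from translation_flow_local[OF \<gamma> this z(3,1) k]
      have ev: "eventually (\<lambda>s. \<exists>x::real. \<gamma> s = Some (z + k * of_real x)) (nhds s)" .
      obtain L where "L \<in> round_circles" "\<And>x. x \<in> \<real> \<Longrightarrow> Some (z + k * x) \<in> L"
        using line_subset_round_circle[OF k] by metis
      then show ?thesis using ev unfolding locally_circular_def
        by (intro bexI[of _ L]) (auto elim!: eventually_mono)
    next
      assume "tangent_form 0 k 0 I \<gamma>" and re: "Re k = 0"
      from linear_flow_local[OF \<gamma> this(1) z(3,1,2) k]
      have ev: "eventually (\<lambda>s. \<exists>x::real. \<gamma> s = Some (z * exp (k * of_real x))) (nhds s)" .
      obtain L where L: "L \<in> round_circles" "\<And>w. norm w = norm z \<Longrightarrow> Some w \<in> L"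
        using centred_circle_subset_round_circle[OF z(2)] by metis
      have "Some (z * exp (k * of_real x)) \<in> L" for x :: real
        by (rule L(2)) (simp add: norm_mult re)
      then show ?thesis using ev L(1) unfolding locally_circular_def
        by (intro bexI[of _ L]) (auto elim!: eventually_mono)
    next
      assume "tangent_form 0 k 0 I \<gamma>" and im: "Im k = 0"
      from linear_flow_local[OF \<gamma> this(1) z(3,1,2) k]
      have ev: "eventually (\<lambda>s. \<exists>x::real. \<gamma> s = Some (z * exp (k * of_real x))) (nhds s)" .
      obtain L where L: "L \<in> round_circles" "\<And>x. x \<in> \<real> \<Longrightarrow> Some (0 + z * x) \<in> L"
        using line_subset_round_circle[OF z(2)] by metis
      have "exp (k * of_real x) \<in> \<real>" for x :: real
        using im by (simp add: complex_is_Real_iff Im_exp)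
      then have "Some (z * exp (k * of_real x)) \<in> L" for x :: real using L(2) by fastforce
      then show ?thesis using ev L(1) unfolding locally_circular_def
        by (intro bexI[of _ L]) (auto elim!: eventually_mono)
    qed
  qed
qed (rule that)

lemma spiral_flow_avoids_poles:
  assumes \<gamma>: "smooth_curve I \<gamma>" "tangent_form 0 k 0 I \<gamma>" "t \<in> I" and k: "Im k \<noteq> 0"
  shows "\<gamma> t \<noteq> None \<and> \<gamma> t \<noteq> Some 0"
proof -
  obtain S U V
    where t: "t \<in> S" "S \<subseteq> I" and lift: "jet_lift S \<gamma> U V"
      using smooth_curveE[OF \<gamma>(1,3)] by metis
  note J = jet_liftD[OF lift]
  define W where "W s = U 1 s * V 0 s - U 0 s * V 1 s" for s
  have W: "isCont W t" "W t \<noteq> 0" "\<And>s. s \<in> S \<Longrightarrow> W s \<noteq> 0"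
    unfolding W_def using J(5) t by (auto intro!: continuous_intros J(7,8))
  have inS: "eventually (\<lambda>s. s \<in> S) (at t)"
    using J(1) t(1) by (auto simp: eventually_at_topological)
  have Q: "k * (U 0 s * V 0 s) / W s \<in> \<real>" if "s \<in> S" for s
  proof -
    have "s \<in> S \<inter> I" using that t(2) by blast
    then have "(0 * (U 0 s)\<^sup>2 + k * (U 0 s * V 0 s) + 0 * (V 0 s)\<^sup>2) / (U 1 s * V 0 s - U 0 s * V 1 s) \<in> \<real>"
      using \<gamma>(2) lift unfolding tangent_form_def by blast
    then show ?thesis by (simp add: W_def)
  qed
  \<comment> \<open>Here \<open>f\<close> is the coordinate vanishing at \<open>t\<close> and
    \<open>g\<close> the other one. Dividing the real ratio by the real number s - t keeps it real,
    and so does the limit, since the reals are closed.\<close>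
  have real: "k * (f1 * g t) / W t \<in> \<real>"
    if f: "(f has_vector_derivative f1) (at t)" "f t = 0" "isCont g t" "\<And>s. f s * g s = U 0 s * V 0 s"
    for f g :: "real \<Rightarrow> complex" and f1
  proof (rule Lim_in_closed_set[OF closed_complex_Reals])
    show "((\<lambda>s. k * ((f s - f t) / of_real (s - t) * g s) / W s) \<longlongrightarrow> k * (f1 * g t) / W t) (at t)"
      using W f(3) by (intro tendsto_intros tendsto_difference_quotient f(1)) (auto simp: isCont_def)
    show "eventually (\<lambda>s. k * ((f s - f t) / of_real (s - t) * g s) / W s \<in> \<real>) (at t)"
      using inS
    proof eventually_elim
      case (elim s)
      have "k * ((f s - f t) / of_real (s - t) * g s) / W s = (k * (U 0 s * V 0 s) / W s) / of_real (s - t)"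
        using f(2,4) by (simp flip: f(4))
      also have "\<dots> \<in> \<real>" by (rule Reals_divide[OF Q[OF elim] Reals_of_real])
      finally show ?case .
    qed
  qed auto
  have kR: "k \<notin> \<real>" using k by (simp add: complex_is_Real_iff)
  have "U 0 t \<noteq> 0"
  proof
    assume u: "U 0 t = 0"
    have "k * (U 1 t * V 0 t) / W t \<in> \<real>"
      using real[of "U 0" "U 1 t" "V 0"] J(2)[OF t(1), of 0] J(8)[OF t(1)] u by simp
    moreover have "U 1 t * V 0 t = W t" by (simp add: W_def u)
    ultimately show False using kR W(2) by simp
  qed
  moreover have "V 0 t \<noteq> 0"
  proof
    assume v: "V 0 t = 0"
    have "k * (V 1 t * U 0 t) / W t \<in> \<real>"
      using real[of "V 0" "V 1 t" "U 0"] J(3)[OF t(1), of 0] J(7)[OF t(1)] v by (simp add: mult.commute)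
    moreover have "V 1 t * U 0 t = - W t" by (simp add: W_def v)
    ultimately show False using kR W(2) by simp
  qed
  ultimately show ?thesis using J(4)[OF t(1)] by (auto simp: proj_def)
qed

section \<open>Curves as open arcs of their circle or loxodrome\<close>

lemma nonzero_derivative_open_image:
  fixes f :: "real \<Rightarrow> real"
  assumes "open S" and d: "\<And>x. x \<in> S \<Longrightarrow> \<exists>D. (f has_real_derivative D) (at x) \<and> D \<noteq> 0"
  shows "open (f ` S)"
proof -
  have "continuous_on S f"
    using d by (meson DERIV_isCont continuous_at_imp_continuous_on)
  then have "f x \<in> interior (f ` S)" if x: "x \<in> S" for x
  proof -
    obtain D where D: "(f has_real_derivative D) (at x)" "D \<noteq> 0" using d[OF x] by blast
    show ?thesis
      by (rule sussmann_open_mapping[OF assms(1) \<open>continuous_on S f\<close> x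
            D(1)[unfolded has_field_derivative_def] bounded_linear_mult_right[of "1 / D"]])
        (use D(2) assms(1) x in \<open>auto simp: fun_eq_iff interior_open\<close>)
  qed
  then show ?thesis by (metis image_subset_iff interior_subset open_interior subset_antisym)
qed

text \<open>The modulus supplies a parameter \<theta> = ln |z| / \<beta> on all of \<open>I\<close>,
  so no local orbits have to be glued: z exp (-l \<theta>) has derivative 0 and is a constant
  \<open>c\<close>, and the curve is an arc of the spiral scaled by \<open>c\<close>.\<close>

lemma spiral_flow_curve_loxodromic:
  assumes \<gamma>: "smooth_curve I \<gamma>" "tangent_form 0 k 0 I \<gamma>" and k: "Re k \<noteq> 0" "Im k \<noteq> 0"
  obtains L where "L \<in> loxodromes (Re k / Im k)" "openin (subtopology cp1_top L) (\<gamma> ` I)"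
proof -
  have I: "open I" "connected I" "I \<noteq> {}" using \<gamma>(1) by (auto simp: smooth_curve_def)
  \<comment> \<open>This makes k a real multiple of \<beta> + i; the two flows differ only in the
    real time scale.\<close>
  define \<beta> where "\<beta> = Re k / Im k"
  have \<beta>: "\<beta> \<noteq> 0" using k by (simp add: \<beta>_def)
  define l where "l = complex_of_real \<beta> + \<i>"
  have l0: "l \<noteq> 0" by (auto simp: l_def complex_eq_iff)
  have kl: "k = of_real (Im k) * l" using k by (simp add: l_def \<beta>_def complex_eq_iff)
  define z where "z s = the (\<gamma> s)" for s
  have \<gamma>z: "\<gamma> s = Some (z s)" "z s \<noteq> 0" if "s \<in> I" for s
    using spiral_flow_avoids_poles[OF \<gamma> that k(2)] by (auto simp: z_def)
  define \<theta> where "\<theta> s = ln (norm (z s)) / \<beta>" for s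
  have der: "\<exists>x. x \<noteq> 0 \<and> (z has_vector_derivative of_real x * l * z s) (at s) \<and>
      (\<theta> has_real_derivative x) (at s)" if s: "s \<in> I" for s
  proof -
    obtain D where D: "((\<lambda>s. the (\<gamma> s)) has_vector_derivative D) (at s)" "D \<noteq> 0"
      "\<And>a b c. tangent_form a b c I \<gamma> \<Longrightarrow> (a * (the (\<gamma> s))\<^sup>2 + b * the (\<gamma> s) + c) / D \<in> \<real>"
      using smooth_curve_affine_derivative[OF \<gamma>(1) s] \<gamma>z[OF s]
        by (metis option.distinct(1))
    have dz: "(z has_vector_derivative D) (at s)" using D(1) by (simp add: z_def[abs_def])
    have "k * z s / D \<in> \<real>" using D(3)[OF \<gamma>(2)] by (simp add: z_def)
    then have "D / (k * z s) \<in> \<real>" by (rule inverse_in_Reals)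
    then obtain y where y: "D / (k * z s) = complex_of_real y" by (auto elim: Reals_cases)
    have k0: "k \<noteq> 0" using k by auto
    have "D = of_real y * (k * z s)" using y k0 \<gamma>z(2)[OF s] by (simp add: field_simps)
    also have "\<dots> = of_real (y * Im k) * l * z s" by (subst kl) simp
    finally have Dx: "D = of_real (y * Im k) * l * z s" .
    have "(\<theta> has_vector_derivative Re (D / z s) / \<beta>) (at s)"
      unfolding \<theta>_def
        by (intro has_vector_derivative_divide ln_norm_has_derivative dz \<gamma>z s)
    moreover have "D / z s = of_real (y * Im k) * l" using \<gamma>z(2)[OF s] by (simp add: Dx)
    then have "Re (D / z s) / \<beta> = y * Im k" using \<beta> by (simp add: l_def)
    ultimately have "(\<theta> has_real_derivative y * Im k) (at s)"
      by (simp add: has_real_derivative_iff_has_vector_derivative)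
    moreover have "y * Im k \<noteq> 0" using Dx D(2) by auto
    ultimately show ?thesis using dz Dx by (intro exI[of _ "y * Im k"]) auto
  qed
  have "((\<lambda>s. z s * exp (- l * of_real (\<theta> s))) has_derivative (\<lambda>h. 0)) (at s)" if s: "s \<in> I" for s
  proof -
    obtain x where x: "(z has_vector_derivative of_real x * l * z s) (at s)" "(\<theta> has_real_derivative x) (at s)"
      using der[OF s] by blast
    have "((\<lambda>y. exp (- l * of_real (\<theta> y))) has_vector_derivative
        x *\<^sub>R (- l * exp (- l * of_real (\<theta> s)))) (at s)"
      using vector_diff_chain_at[OF x(2)[unfolded has_real_derivative_iff_has_vector_derivative]
          has_vector_derivative_exp_mult[of "- l"]] by (simp add: o_def)
    from has_vector_derivative_mult[OF x(1) this]
    have "((\<lambda>s. z s * exp (- l * of_real (\<theta> s))) has_vector_derivative 0) (at s)"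
      by (simp add: scaleR_conv_of_real algebra_simps)
    then show ?thesis by (simp add: has_vector_derivative_def)
  qed
  from has_derivative_zero_unique_connected[OF I(1,2) this]
  obtain c where c: "\<And>s. s \<in> I \<Longrightarrow> z s * exp (- l * of_real (\<theta> s)) = c"
    by (metis)
  have zc: "z s = c * exp (l * of_real (\<theta> s))" if "s \<in> I" for s
    using c[OF that] by (auto simp: exp_minus field_simps)
  have c0: "c \<noteq> 0" using I(3) zc \<gamma>z(2) by fastforce
  define m where "m = moebius_cp1 c 0 0 1"
  have m: "m \<in> moebius_maps" unfolding m_def using c0 by (intro moebius_maps_of_det) simp
  define A where "A = (\<lambda>s. Some (exp (l * of_real (\<theta> s)))) ` I"
  have mA: "m ` A = \<gamma> ` I"
    unfolding A_def image_image
    by (rule image_cong) (auto simp: m_def moebius_cp1_def moebius_def \<gamma>z zc)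
  have "open (\<theta> ` I)"
    by (rule nonzero_derivative_open_image[OF I(1)]) (use der in blast)
  then have o: "open {w :: complex. w \<noteq> 0 \<and> ln (norm w) / \<beta> \<in> \<theta> ` I}"
  proof -
    have "continuous_on (- {0}) (\<lambda>w :: complex. ln (norm w) / \<beta>)"
      using \<beta> by (intro continuous_intros) auto
    from continuous_open_preimage[OF this _ \<open>open (\<theta> ` I)\<close>]
    show ?thesis by (simp add: Int_def vimage_def open_Compl)
  qed
  have ln: "ln (norm (exp (l * of_real x))) / \<beta> = x" for x :: real
    using \<beta> by (simp add: l_def)
  \<comment> \<open>The spiral meets each circle about 0 exactly once, so an open condition on the
    modulus cuts out the arc.\<close>
  have "A = Some ` {w. w \<noteq> 0 \<and> ln (norm w) / \<beta> \<in> \<theta> ` I} \<inter> log_spiral \<beta>"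
  proof
    show "A \<subseteq> Some ` {w. w \<noteq> 0 \<and> ln (norm w) / \<beta> \<in> \<theta> ` I} \<inter> log_spiral \<beta>"
      unfolding A_def log_spiral_def l_def[symmetric] using ln by auto
    show "Some ` {w. w \<noteq> 0 \<and> ln (norm w) / \<beta> \<in> \<theta> ` I} \<inter> log_spiral \<beta> \<subseteq> A"
    proof
      fix x assume "x \<in> Some ` {w. w \<noteq> 0 \<and> ln (norm w) / \<beta> \<in> \<theta> ` I} \<inter> log_spiral \<beta>"
      then obtain y where y: "x = Some (exp (l * complex_of_real y))"
        "ln (norm (exp (l * complex_of_real y))) / \<beta> \<in> \<theta> ` I"
        unfolding log_spiral_def l_def[symmetric] by blast
      then show "x \<in> A" unfolding ln A_def by auto
    qed
  qed
  moreover have "openin cp1_top (Some ` {w. w \<noteq> 0 \<and> ln (norm w) / \<beta> \<in> \<theta> ` I})"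
    unfolding cp1_top_def
      by (rule openin_Alexandroff_compactification_image_Some[THEN iffD2]) (use o in simp)
  ultimately have "openin (subtopology cp1_top (log_spiral \<beta>)) A"
    unfolding openin_subtopology by blast
  from openin_subtopology_moebius_image[OF m this]
  have "openin (subtopology cp1_top (m ` log_spiral \<beta>)) (\<gamma> ` I)" by (simp add: mA)
  moreover have "m ` log_spiral \<beta> \<in> loxodromes \<beta>" using m by (auto simp: loxodromes_def)
  ultimately show ?thesis using that by (auto simp: \<beta>_def)
qed

text \<open>Openness is checked near each point, with the circle moved to \<open>rp1\<close> and the
  point to 0. There the coordinate is a real function with nonzero derivative, whose image is open
  in the real line.\<close>

lemma curve_open_in_round_circle:
  assumes \<gamma>: "smooth_curve I \<gamma>" and L: "L \<in> round_circles" "\<gamma> ` I \<subseteq> L"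
  shows "openin (subtopology cp1_top L) (\<gamma> ` I)"
proof (subst openin_subopen, intro ballI)
  fix y assume "y \<in> \<gamma> ` I"
  then obtain t where t: "t \<in> I" "y = \<gamma> t" by blast
  then have "\<gamma> t \<in> L" using L(2) by blast
  then obtain m where m: "m \<in> moebius_maps" "L = m ` rp1" "\<gamma> t = m (Some 0)"
    by (rule round_circle_with_base_point[OF L(1)])
  obtain n where n: "n \<in> moebius_maps" "\<And>x. m (n x) = x" "\<And>x. n (m x) = x"
    using moebius_maps_inverse[OF m(1)] by metis
  define \<delta> where "\<delta> = n \<circ> \<gamma>"
  have \<delta>: "smooth_curve I \<delta>"
    unfolding \<delta>_def by (rule smooth_curve_moebius[OF n(1) \<gamma>])
  have \<delta>t: "\<delta> t = Some 0" by (simp add: \<delta>_def m n)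
  have \<delta>rp1: "\<delta> s \<in> rp1" if "s \<in> I" for s
    using L(2) that n m(2) by (auto simp: \<delta>_def)
  have \<gamma>\<delta>: "\<gamma> ` I = m ` \<delta> ` I" by (simp add: \<delta>_def image_image n)
  have "eventually (\<lambda>s. s \<in> I \<and> \<delta> s \<noteq> None) (nhds t)"
    by (rule smooth_curve_eventually_affine[OF \<delta> t(1)]) (simp add: \<delta>t)
  then obtain S
    where S: "open S" "t \<in> S" "\<And>s. s \<in> S \<Longrightarrow> s \<in> I \<and> \<delta> s \<noteq> None"
    by (auto simp: eventually_nhds)
  define z where "z s = the (\<delta> s)" for s
  have \<delta>z: "\<delta> s = Some (z s)" "Im (z s) = 0" if "s \<in> S" for s
    using S(3)[OF that] \<delta>rp1[of s] by (auto simp: z_def rp1_def complex_is_Real_iff)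
  have "open ((\<lambda>s. Re (z s)) ` S)"
  proof (rule nonzero_derivative_open_image[OF S(1)])
    fix s assume s: "s \<in> S"
    obtain D where D: "(z has_vector_derivative D) (at s)" "D \<noteq> 0"
      using smooth_curve_affine_derivative[OF \<delta>] S(3)[OF s] unfolding z_def[abs_def] by metis
    have "Im D = 0"
      using vector_derivative_zero_of_vanishing[OF
          bounded_linear.has_vector_derivative[OF bounded_linear_Im D(1)] S(1) s] \<delta>z(2) by blast
    then have "Re D \<noteq> 0" using D(2) by (simp add: complex_eq_iff)
    moreover have "((\<lambda>s. Re (z s)) has_real_derivative Re D) (at s)"
      using D(1) by (simp add: has_vector_derivative_complex_iff)
    ultimately show "\<exists>D. ((\<lambda>s. Re (z s)) has_real_derivative D) (at s) \<and> D \<noteq> 0"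
      by blast
  qed
  \<comment> \<open>A union of vertical lines: open in the plane, with the given open set of reals
    as its trace on the real axis.\<close>
  then have "open (Re -` (\<lambda>s. Re (z s)) ` S)" by (rule open_vimage) (intro continuous_intros)
  then have "openin cp1_top (Some ` (Re -` (\<lambda>s. Re (z s)) ` S))" by (simp add: cp1_top_def)
  then have "openin (subtopology cp1_top rp1) (Some ` (Re -` (\<lambda>s. Re (z s)) ` S) \<inter> rp1)"
    by (auto simp: openin_subtopology)
  moreover have "Some ` (Re -` (\<lambda>s. Re (z s)) ` S) \<inter> rp1 = \<delta> ` S"
  proof (intro equalityI subsetI)
    fix x assume "x \<in> Some ` (Re -` (\<lambda>s. Re (z s)) ` S) \<inter> rp1"
    then obtain w s where "x = Some w" "Re w = Re (z s)" "s \<in> S" "Im w = 0"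
      by (auto simp: rp1_def complex_is_Real_iff)
    then have "x = \<delta> s" using \<delta>z[of s] by (simp add: complex_eq_iff)
    then show "x \<in> \<delta> ` S" using \<open>s \<in> S\<close> by blast
  next
    fix x assume "x \<in> \<delta> ` S"
    then obtain s where "s \<in> S" "x = \<delta> s" by blast
    then show "x \<in> Some ` (Re -` (\<lambda>s. Re (z s)) ` S) \<inter> rp1"
      using \<delta>z(1)[of s] \<delta>rp1[of s] S(3)[of s] by auto
  qed
  ultimately have "openin (subtopology cp1_top rp1) (\<delta> ` S)" by simp
  from openin_subtopology_moebius_image[OF m(1) this]
  have "openin (subtopology cp1_top L) (m ` \<delta> ` S)" by (simp add: m(2))
  moreover have "y \<in> m ` \<delta> ` S" using t(2) S(2) m(3) \<delta>t by force
  moreover have "m ` \<delta> ` S \<subseteq> \<gamma> ` I"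
    unfolding \<gamma>\<delta> using S(3) by blast
  ultimately show "\<exists>T. openin (subtopology cp1_top L) T \<and> y \<in> T \<and> T \<subseteq> \<gamma> ` I"
    by blast
qed

section \<open>Uniqueness of the classifying curve\<close>

text \<open>The spiral parameter is continuous along the curve and not constant, since the velocity
  does not vanish; its range therefore contains an interval. This brings containment of curves to
  the form in which the exponentials can be compared.\<close>

lemma curve_in_loxodrome_contains_arc:
  assumes \<gamma>: "smooth_curve I \<gamma>" and L: "L \<in> loxodromes \<beta>" "\<beta> \<noteq> 0" "\<gamma> ` I \<subseteq> L"
  obtains m a b where "m \<in> moebius_maps" "L = m ` log_spiral \<beta>" "a < b"
    "\<And>\<theta>::real. a < \<theta> \<Longrightarrow> \<theta> < b \<Longrightarrow> m (Some (exp ((of_real \<beta> + \<i>) * of_real \<theta>))) \<in> \<gamma> ` I"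
proof -
  have I: "open I" "connected I" "I \<noteq> {}" using \<gamma> by (auto simp: smooth_curve_def)
  obtain m where m: "m \<in> moebius_maps" "L = m ` log_spiral \<beta>"
    using L(1) by (auto simp: loxodromes_def)
  obtain n where n: "n \<in> moebius_maps" "\<And>x. m (n x) = x" "\<And>x. n (m x) = x"
    using moebius_maps_inverse[OF m(1)] by metis
  define \<delta> where "\<delta> = n \<circ> \<gamma>"
  have \<delta>: "smooth_curve I \<delta>"
    unfolding \<delta>_def by (rule smooth_curve_moebius[OF n(1) \<gamma>])
  have m\<delta>: "m (\<delta> s) = \<gamma> s" for s by (simp add: \<delta>_def n)
  have \<delta>S: "\<delta> s \<in> log_spiral \<beta>" if "s \<in> I" for s
    using L(3) that n m(2) by (auto simp: \<delta>_def)
  define z where "z s = the (\<delta> s)" for s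
  have \<delta>z: "\<delta> s = Some (z s)" "z s \<noteq> 0" if "s \<in> I" for s
    using \<delta>S[OF that] by (auto simp: z_def log_spiral_def)
  define \<theta> where "\<theta> s = ln (norm (z s)) / \<beta>" for s
  have z\<theta>: "z s = exp ((of_real \<beta> + \<i>) * of_real (\<theta> s))" if "s \<in> I" for s
    unfolding \<theta>_def
      by (rule log_spiral_eq_exp_ln[OF L(2)]) (use \<delta>S[OF that] \<delta>z(1)[OF that] in simp)
  have dz: "\<exists>D. (z has_vector_derivative D) (at s) \<and> D \<noteq> 0" if "s \<in> I" for s
    using smooth_curve_affine_derivative[OF \<delta> that] \<delta>z[OF that]
      unfolding z_def[abs_def] by (metis option.distinct(1))
  have cont: "continuous_on I \<theta>"
  proof -
    have "continuous_on I z"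
      using dz by (meson continuous_at_imp_continuous_on has_vector_derivative_continuous)
    then show ?thesis unfolding \<theta>_def using \<delta>z(2) L(2) by (intro continuous_intros) auto
  qed
  obtain t where t: "t \<in> I" using I(3) by blast
  have "\<exists>s\<in>I. \<theta> s \<noteq> \<theta> t"
  proof (rule ccontr)
    assume "\<not> ?thesis"
    then have const: "z s = z t" if "s \<in> I" for s using z\<theta> t that by metis
    obtain D where D: "(z has_vector_derivative D) (at t)" "D \<noteq> 0" using dz[OF t] by blast
    have "((\<lambda>s. z s - z t) has_vector_derivative D) (at t)"
      using has_vector_derivative_diff[OF D(1) has_vector_derivative_const] by simp
    from vector_derivative_zero_of_vanishing[OF this I(1) t] const D(2) show False by simp
  qed
  then obtain s where s: "s \<in> I" "\<theta> s \<noteq> \<theta> t" by blast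
  define a b where "a = min (\<theta> s) (\<theta> t)" and "b = max (\<theta> s) (\<theta> t)"
  have "connected (\<theta> ` I)" using cont I(2) by (rule connected_continuous_image)
  then have sub: "{a..b} \<subseteq> \<theta> ` I"
    using s t by (intro connected_contains_Icc) (auto simp: a_def b_def min_def max_def)
  show ?thesis
  proof (rule that[OF m])
    show "a < b" using s(2) by (auto simp: a_def b_def)
    fix x assume "a < x" "x < b"
    then have "x \<in> \<theta> ` I" using sub by (simp add: subset_iff)
    then obtain r where r: "r \<in> I" "x = \<theta> r" by blast
    then have "m (Some (exp ((of_real \<beta> + \<i>) * of_real x))) = \<gamma> r"
      using m\<delta>[of r] \<delta>z(1) z\<theta> by simp
    then show "m (Some (exp ((of_real \<beta> + \<i>) * of_real x))) \<in> \<gamma> ` I" using r by simp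
  qed
qed

lemma curve_not_in_circle_and_loxodrome:
  assumes \<gamma>: "smooth_curve I \<gamma>" and L: "L \<in> loxodromes \<beta>" "\<beta> \<noteq> 0" "\<gamma> ` I \<subseteq> L"
    and K: "K \<in> round_circles" "\<gamma> ` I \<subseteq> K"
  shows False
proof -
  obtain m a b where m: "m \<in> moebius_maps" "a < b"
    "\<And>\<theta>::real. a < \<theta> \<Longrightarrow> \<theta> < b \<Longrightarrow> m (Some (exp ((of_real \<beta> + \<i>) * of_real \<theta>))) \<in> \<gamma> ` I"
    using curve_in_loxodrome_contains_arc[OF \<gamma> L] by metis
  obtain n where n: "n \<in> moebius_maps" "\<And>x. n (m x) = x"
    using moebius_maps_inverse[OF m(1)] by metis
  have "Some (exp ((of_real \<beta> + \<i>) * of_real \<theta>)) \<in> n ` K"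
    if "a < \<theta>" "\<theta> < b" for \<theta> :: real
    using m(3)[OF that] K(2) n(2) by (metis image_eqI subsetD)
  then show False
    using spiral_arc_not_in_circle[OF m(2) L(2) moebius_image_round_circles[OF n(1) K(1)]] by blast
qed

lemma curve_in_two_loxodromes:
  assumes \<gamma>: "smooth_curve I \<gamma>" and L: "L \<in> loxodromes \<beta>" "\<beta> \<noteq> 0" "\<gamma> ` I \<subseteq> L"
    and L': "L' \<in> loxodromes \<beta>'" "\<beta>' \<noteq> 0" "\<gamma> ` I \<subseteq> L'"
  shows "\<beta> = \<beta>' \<and> L = L'"
proof -
  obtain m a b where m: "m \<in> moebius_maps" "L = m ` log_spiral \<beta>" "a < b"
    "\<And>\<theta>::real. a < \<theta> \<Longrightarrow> \<theta> < b \<Longrightarrow> m (Some (exp ((of_real \<beta> + \<i>) * of_real \<theta>))) \<in> \<gamma> ` I"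
    using curve_in_loxodrome_contains_arc[OF \<gamma> L] by metis
  obtain m'
    where m': "m' \<in> moebius_maps" "L' = m' ` log_spiral \<beta>'"
      using L'(1) by (auto simp: loxodromes_def)
  obtain n where n: "n \<in> moebius_maps" "\<And>x. m' (n x) = x" "\<And>x. n (m' x) = x"
    using moebius_maps_inverse[OF m'(1)] by metis
  obtain p q r s where N: "n \<circ> m = moebius_cp1 p q r s" "p * s - q * r = 1"
    using moebius_maps_comp[OF n(1) m(1)] by (auto simp: moebius_maps_def)
  have "moebius_cp1 p q r s (Some (exp ((of_real \<beta> + \<i>) * of_real \<theta>))) \<in> log_spiral \<beta>'"
    if "a < \<theta>" "\<theta> < b" for \<theta> :: real
  proof -
    have "m (Some (exp ((of_real \<beta> + \<i>) * of_real \<theta>))) \<in> m' ` log_spiral \<beta>'"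
      using m(4)[OF that] L'(3) m'(2) by blast
    then show ?thesis unfolding N(1)[symmetric] using n(3) by auto
  qed
  from moebius_spiral_arc_in_spiral[OF m(3) L(2) L'(2) N(2) this]
  have *: "\<beta> = \<beta>'" "(n \<circ> m) ` log_spiral \<beta> = log_spiral \<beta>'"
    unfolding N(1) by auto
  have "L' = m' ` (n \<circ> m) ` log_spiral \<beta>" by (simp only: *(2) m'(2))
  also have "\<dots> = L" by (simp add: image_image n(2) m(2))
  finally show ?thesis using * by simp
qed

section \<open>The classification\<close>

lemma conformally_homogeneousE:
  assumes "conformally_homogeneous C"
  obtains I \<gamma> a b c
    where "smooth_curve I \<gamma>" "C = \<gamma> ` I" "tangent_form a b c I \<gamma>"
    "a \<noteq> 0 \<or> b \<noteq> 0 \<or> c \<noteq> 0" "connectedin cp1_top C"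
proof -
  obtain I \<gamma> X where reg: "regular_parametrisation I \<gamma>" and C: "C = \<gamma> ` I"
    and X: "X \<in> symmetry_algebra I \<gamma>" "X \<noteq> (\<lambda>k z. 0)"
    using assms unfolding conformally_homogeneous_def by blast
  obtain a b c where abc: "X = ckf a b c" "tangent_along (ckf a b c) I \<gamma>"
    using X(1) by (auto simp: symmetry_algebra_def conformal_killing_fields_def)
  have "a \<noteq> 0 \<or> b \<noteq> 0 \<or> c \<noteq> 0"
  proof (rule ccontr)
    assume "\<not> ?thesis"
    then have "ckf a b c k z = 0" for k z by (cases k) auto
    then show False using X(2) abc(1) by (simp add: fun_eq_iff)
  qed
  moreover have "connectedin cp1_top C"
    unfolding C using reg
    by (intro connectedin_continuous_map_image[of "top_of_set I"])
      (auto simp: regular_parametrisation_def connectedin_subtopology)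
  ultimately show ?thesis
    using that regular_parametrisation_imp_smooth_curve[OF reg] C tangent_along_imp_tangent_form[OF abc(2)]
    by blast
qed

lemma conformally_homogeneous_open_arc:
  assumes "conformally_homogeneous C"
  obtains L
    where "L \<in> round_circles \<or> (\<exists>\<beta>. \<beta> \<noteq> 0 \<and> L \<in> loxodromes \<beta>)" "connected_open_arc_of C L"
proof -
  obtain I \<gamma> a b c
    where \<gamma>: "smooth_curve I \<gamma>" "C = \<gamma> ` I" "tangent_form a b c I \<gamma>"
    and nz: "a \<noteq> 0 \<or> b \<noteq> 0 \<or> c \<noteq> 0" and conn: "connectedin cp1_top C"
    using conformally_homogeneousE[OF assms] by metis
  obtain p q r s k where N: "p * s - q * r = 1" "k \<noteq> 0"
    "(\<forall>u v. a * u\<^sup>2 + b * (u * v) + c * v\<^sup>2 = k * ((p * u + q * v) * (r * u + s * v))) \<or>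
     (\<forall>u v. a * u\<^sup>2 + b * (u * v) + c * v\<^sup>2 = k * (r * u + s * v)\<^sup>2)"
    using quadratic_normal_form[OF nz] by metis
  \<comment> \<open>\<open>m\<close> moves the zeros of the quadratic form to 0 and infinity, or a
    double zero to infinity; \<open>n\<close> carries the model curve back.\<close>
  define m where "m = moebius_cp1 p q r s"
  define \<delta> where "\<delta> = m \<circ> \<gamma>"
  have m: "m \<in> moebius_maps" unfolding m_def using N(1) by (intro moebius_maps_of_det) simp
  obtain n where n: "n \<in> moebius_maps" "\<And>x. n (m x) = x"
    using moebius_maps_inverse[OF m] by metis
  have \<delta>: "smooth_curve I \<delta>"
    unfolding \<delta>_def by (rule smooth_curve_moebius[OF m \<gamma>(1)])
  have tang: "tangent_form 0 k 0 I \<delta> \<or> tangent_form 0 0 k I \<delta>"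
    using N(3)
  proof
    assume h: "\<forall>u v. a * u\<^sup>2 + b * (u * v) + c * v\<^sup>2 = k * ((p * u + q * v) * (r * u + s * v))"
    have "tangent_form 0 k 0 I \<delta>" unfolding \<delta>_def m_def
      by (rule tangent_form_moebius[OF N(1) \<gamma>(3)]) (use h in simp)
    then show ?thesis ..
  next
    assume h: "\<forall>u v. a * u\<^sup>2 + b * (u * v) + c * v\<^sup>2 = k * (r * u + s * v)\<^sup>2"
    have "tangent_form 0 0 k I \<delta>" unfolding \<delta>_def m_def
      by (rule tangent_form_moebius[OF N(1) \<gamma>(3)]) (use h in simp)
    then show ?thesis ..
  qed
  have "\<exists>L. (L \<in> round_circles \<or> (\<exists>\<beta>. \<beta> \<noteq> 0 \<and> L \<in> loxodromes \<beta>)) \<and> openin (subtopology cp1_top L) (\<delta> ` I)"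
  proof (cases "tangent_form 0 k 0 I \<delta> \<and> Re k \<noteq> 0 \<and> Im k \<noteq> 0")
    case True
    then obtain L
      where "L \<in> loxodromes (Re k / Im k)" "openin (subtopology cp1_top L) (\<delta> ` I)"
      using spiral_flow_curve_loxodromic[OF \<delta>] by metis
    then show ?thesis using True by (intro exI[of _ L]) (auto intro!: exI[of _ "Re k / Im k"])
  next
    case False
    then have "tangent_form 0 0 k I \<delta> \<or> tangent_form 0 k 0 I \<delta> \<and> (Re k = 0 \<or> Im k = 0)"
      using tang by blast
    then obtain L where L: "L \<in> round_circles" "\<delta> ` I \<subseteq> L"
      using flow_curve_circular[OF \<delta> N(2)] by metis
    then show ?thesis using curve_open_in_round_circle[OF \<delta> L] by blast
  qed
  then obtain L
    where L: "L \<in> round_circles \<or> (\<exists>\<beta>. \<beta> \<noteq> 0 \<and> L \<in> loxodromes \<beta>)"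
    "openin (subtopology cp1_top L) (\<delta> ` I)" by blast
  show ?thesis
  proof (rule that[of "n ` L"])
    show "n ` L \<in> round_circles \<or> (\<exists>\<beta>. \<beta> \<noteq> 0 \<and> n ` L \<in> loxodromes \<beta>)"
      using L(1) moebius_image_round_circles[OF n(1)] moebius_image_loxodromes[OF n(1)] by blast
    have "n ` \<delta> ` I = C" by (simp add: \<gamma>(2) \<delta>_def image_image n)
    then have "openin (subtopology cp1_top (n ` L)) C"
      using openin_subtopology_moebius_image[OF n(1) L(2)] by simp
    moreover have "C \<noteq> {}" using \<gamma>(1,2) by (auto simp: smooth_curve_def)
    ultimately show "connected_open_arc_of C (n ` L)" using conn by (simp add: connected_open_arc_of_def)
  qed
qed

lemma classifying_curve_iff:
  "L \<in> round_circles \<union> right_handed_loxodromes \<union> left_handed_loxodromes \<longleftrightarrow>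
     L \<in> round_circles \<or> (\<exists>\<beta>. \<beta> \<noteq> 0 \<and> L \<in> loxodromes \<beta>)"
  by (auto simp: right_handed_loxodromes_def left_handed_loxodromes_def neq_iff)

theorem theorem3:
  shows "(\<forall>L \<in> round_circles \<union> right_handed_loxodromes \<union> left_handed_loxodromes.
            conformally_homogeneous L) \<and>
         (\<forall>C. conformally_homogeneous C \<longrightarrow>
            (\<exists>!L. L \<in> round_circles \<union> right_handed_loxodromes \<union> left_handed_loxodromes \<and>
                  connected_open_arc_of C L)) \<and>
         round_circles \<inter> right_handed_loxodromes = {} \<and>
         round_circles \<inter> left_handed_loxodromes = {} \<and>
         right_handed_loxodromes \<inter> left_handed_loxodromes = {} \<and>
         (\<forall>\<beta> \<beta>'. \<beta> \<noteq> 0 \<and> \<beta>' \<noteq> 0 \<and> \<beta> \<noteq> \<beta>' \<longrightarrow> loxodromes \<beta> \<inter> loxodromes \<beta>' = {})"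
proof -
  have unique: "L = L'"
    if \<gamma>: "smooth_curve I \<gamma>" "\<gamma> ` I \<subseteq> L" "\<gamma> ` I \<subseteq> L'"
      and L: "L \<in> round_circles \<or> (\<exists>\<beta>. \<beta> \<noteq> 0 \<and> L \<in> loxodromes \<beta>)"
      and L': "L' \<in> round_circles \<or> (\<exists>\<beta>. \<beta> \<noteq> 0 \<and> L' \<in> loxodromes \<beta>)" for I \<gamma> L L'
  proof -
    obtain t where t: "open I" "t \<in> I" "t \<in> closure I"
      using \<gamma>(1) closure_subset unfolding smooth_curve_def by blast
    show ?thesis
      using L L' curve_not_in_circle_and_loxodrome[OF \<gamma>(1)] curve_in_two_loxodromes[OF \<gamma>(1)]
        round_circle_unique[OF \<gamma>(1) t(2,1,3) _ _ t(1,3)] \<gamma>(2,3) by metis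
  qed
  have homogeneous: "conformally_homogeneous L"
    if "L \<in> round_circles \<or> (\<exists>\<beta>. \<beta> \<noteq> 0 \<and> L \<in> loxodromes \<beta>)" for L
    using that round_circle_conformally_homogeneous loxodrome_conformally_homogeneous by blast
  have classification: "\<exists>!L. (L \<in> round_circles \<or> (\<exists>\<beta>. \<beta> \<noteq> 0 \<and> L \<in> loxodromes \<beta>)) \<and> connected_open_arc_of C L"
    if C: "conformally_homogeneous C" for C
  proof -
    obtain I \<gamma>
      where \<gamma>: "smooth_curve I \<gamma>" "C = \<gamma> ` I"
        using conformally_homogeneousE[OF C] by metis
    have sub: "C \<subseteq> L" if "connected_open_arc_of C L" for L
      using that openin_subset[of "subtopology cp1_top L" C] by (simp add: connected_open_arc_of_def)
    obtain L where L: "L \<in> round_circles \<or> (\<exists>\<beta>. \<beta> \<noteq> 0 \<and> L \<in> loxodromes \<beta>)" "connected_open_arc_of C L"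
      using conformally_homogeneous_open_arc[OF C] .
    show ?thesis
    proof (rule ex1I[of _ L])
      fix L' assume L': "(L' \<in> round_circles \<or> (\<exists>\<beta>. \<beta> \<noteq> 0 \<and> L' \<in> loxodromes \<beta>)) \<and> connected_open_arc_of C L'"
      show "L' = L"
        by (rule unique[OF \<gamma>(1)]) (use L L' sub \<gamma>(2) in blast)+
    qed (use L in blast)
  qed
  \<comment> \<open>Disjointness of the classes is again a statement about curves: a common member
    is conformally homogeneous, hence the image of a smooth curve contained in members of both
    classes.\<close>
  have circle_lox: "False" if h: "L \<in> round_circles" "L \<in> loxodromes \<beta>" "\<beta> \<noteq> 0" for L \<beta>
  proof -
    obtain I \<gamma> where "smooth_curve I \<gamma>" "L = \<gamma> ` I"
      using conformally_homogeneousE[OF round_circle_conformally_homogeneous[OF h(1)]] by metis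
    then show False using curve_not_in_circle_and_loxodrome[of I \<gamma> L \<beta> L] h by simp
  qed
  have lox_lox: "\<beta> = \<beta>'" if h: "L \<in> loxodromes \<beta>" "L \<in> loxodromes \<beta>'" "\<beta> \<noteq> 0" "\<beta>' \<noteq> 0" for L \<beta> \<beta>'
  proof -
    obtain I \<gamma> where "smooth_curve I \<gamma>" "L = \<gamma> ` I"
      using conformally_homogeneousE[OF loxodrome_conformally_homogeneous[OF h(1)]] by metis
    then show ?thesis using curve_in_two_loxodromes[of I \<gamma> L \<beta> L \<beta>'] h by simp
  qed
  show ?thesis
  proof (intro conjI ballI allI impI)
    show "conformally_homogeneous L"
      if "L \<in> round_circles \<union> right_handed_loxodromes \<union> left_handed_loxodromes" for L
      using that homogeneous unfolding classifying_curve_iff by blast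
    show "\<exists>!L. L \<in> round_circles \<union> right_handed_loxodromes \<union> left_handed_loxodromes \<and>
        connected_open_arc_of C L" if "conformally_homogeneous C" for C
      using classification[OF that] unfolding classifying_curve_iff .
    show "round_circles \<inter> right_handed_loxodromes = {}" "round_circles \<inter> left_handed_loxodromes = {}"
      using circle_lox by (force simp: right_handed_loxodromes_def left_handed_loxodromes_def)+
    show "right_handed_loxodromes \<inter> left_handed_loxodromes = {}"
      using lox_lox by (force simp: right_handed_loxodromes_def left_handed_loxodromes_def)
    show "loxodromes \<beta> \<inter> loxodromes \<beta>' = {}"
      if "\<beta> \<noteq> 0 \<and> \<beta>' \<noteq> 0 \<and> \<beta> \<noteq> \<beta>'" for \<beta> \<beta>'
      using that lox_lox by blast
  qed
qed

end
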